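(* We have $$A^{2314}(x,q)=1+I^{2314}(x,q)+I^{231}(x,q)\left(A^{2314}(x,q)-1\right),$$ $$A^{3124}(x,q)=1+I^{3124}(x,q)+I^{312}(x,q)\left(A^{3124}(x,q)-1\right).$$ Further, for $\sigma\in\{2314,3124\}$, $$I^\sigma(x)=\frac12\left(\sqrt{1-4x}+1\right)\left(\frac{32x}{1+20x-8x^2-(1-8x)^{3/2}}-1\right),$$ $I^\sigma_1=1$, and for $n\ge2$, $$I^\sigma_n=F_n-\sum_{i=0}^{n-2}C_iF_{n-1-i},$$ where $C_i=\frac1{i+1}\binom{2i}i$ is the $i$-th Catalan number and $F_m$ is the number of $1342$-avoiding permutations of $[m]$.
   Context: For a permutation $\pi=\pi_1\cdots\pi_n$ of $[n]$, let $i_\pi$ be the smallest index $i$ with $\{\pi_1,\dots,\pi_i\}=\{1,\dots,i\}$; $\pi$ is indecomposable if $i_\pi=n$ (the empty permutation is not indecomposable). A permutation $\pi$ avoids a pattern $\tau\in\mathfrak S_k$ if no subsequence $\pi_{j_1}\cdots\pi_{j_k}$ ($j_1<\cdots<j_k$) is order-isomorphic to $\tau$. A descent of $\pi$ is an index $i$ with $\pi_i>\pi_{i+1}$. For a pattern $\sigma$, $A^\sigma_{n,i}$ (resp. $I^\sigma_{n,i}$) is the number of $\sigma$-avoiding permutations (resp. $\sigma$-avoiding indecomposable permutations) of $[n]$ with $i$ descents; $A^\sigma(x,q)=1+\sum_{n\ge1}\sum_iA^\sigma_{n,i}x^nq^i$, $I^\sigma(x,q)=\sum_{n\ge1}\sum_iI^\sigma_{n,i}x^nq^i$,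 $I^\sigma(x)=I^\sigma(x,1)=\sum_{n\ge1}I^\sigma_nx^n$. It is known (Bóna) that the patterns $1342,2314,3124$ are Wilf-equivalent and that $\sum_{m\ge0}F_mx^m=\frac{32x}{1+20x-8x^2-(1-8x)^{3/2}}$, with $F_0=1$. *)

theory Defs
  imports
    "HOL-Combinatorics.Multiset_Permutations"
    "HOL-Computational_Algebra.Computational_Algebra"
begin

text \<open>
  A permutation of \<open>[n]\<close> is written in one-line notation, as a list in
  \<^term>\<open>permutations_of_set {1..n}\<close>; list positions are counted from 0.
\<close>

definition contains_pattern :: "nat list \<Rightarrow> nat list \<Rightarrow> bool" where
  "contains_pattern \<tau> \<pi> \<longleftrightarrow>
     (\<exists>j. strict_mono_on {..<length \<tau>} j \<and> j ` {..<length \<tau>} \<subseteq> {..<length \<pi>} \<and>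
          (\<forall>a<length \<tau>. \<forall>b<length \<tau>. \<pi> ! j a < \<pi> ! j b \<longleftrightarrow> \<tau> ! a < \<tau> ! b))"

definition avoids :: "nat list \<Rightarrow> nat list \<Rightarrow> bool" where
  "avoids \<tau> \<pi> \<longleftrightarrow> \<not> contains_pattern \<tau> \<pi>"

definition descents :: "nat list \<Rightarrow> nat set" where
  "descents \<pi> = {i. Suc i < length \<pi> \<and> \<pi> ! i > \<pi> ! Suc i}"

text \<open>The index \<open>i\<^sub>\<pi>\<close>; index 0 has to be excluded, since the empty prefix qualifies trivially.\<close>

definition first_index :: "nat list \<Rightarrow> nat" where
  "first_index \<pi> = (LEAST i. 1 \<le> i \<and> set (take i \<pi>) = {1..i})"

definition indecomposable :: "nat list \<Rightarrow> bool" where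
  "indecomposable \<pi> \<longleftrightarrow> \<pi> \<noteq> [] \<and> first_index \<pi> = length \<pi>"

definition av_perms :: "nat list \<Rightarrow> nat \<Rightarrow> nat list set" where
  "av_perms \<sigma> n = {\<pi> \<in> permutations_of_set {1..n}. avoids \<sigma> \<pi>}"

definition av_num :: "nat list \<Rightarrow> nat \<Rightarrow> nat \<Rightarrow> nat" where
  "av_num \<sigma> n i = card {\<pi> \<in> av_perms \<sigma> n. card (descents \<pi>) = i}"

definition indec_num :: "nat list \<Rightarrow> nat \<Rightarrow> nat \<Rightarrow> nat" where
  "indec_num \<sigma> n i = card {\<pi> \<in> av_perms \<sigma> n. indecomposable \<pi> \<and> card (descents \<pi>) = i}"

text \<open>
  The series in \<open>x\<close> and \<open>q\<close> are power series in \<open>x\<close> over the polynomials in \<open>q\<close>, so that \<open>q = 1\<close>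
  can be substituted. A permutation of \<open>[n]\<close> with \<open>n \<ge> 1\<close> has fewer than \<open>n\<close> descents, so the
  inner sums over \<open>i < n\<close> omit nothing.
\<close>

definition av_gf :: "nat list \<Rightarrow> real poly fps" where
  "av_gf \<sigma> = 1 + Abs_fps (\<lambda>n. if n = 0 then 0 else \<Sum>i<n. monom (of_nat (av_num \<sigma> n i)) i)"

definition indec_gf :: "nat list \<Rightarrow> real poly fps" where
  "indec_gf \<sigma> = Abs_fps (\<lambda>n. if n = 0 then 0 else \<Sum>i<n. monom (of_nat (indec_num \<sigma> n i)) i)"

text \<open>The series \<open>I\<^sup>\<sigma>(x) = I\<^sup>\<sigma>(x, 1)\<close>; its coefficients are the numbers \<open>I\<^sup>\<sigma>\<^sub>n\<close>.\<close>

definition indec_gf1 :: "nat list \<Rightarrow> real fps" where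
  "indec_gf1 \<sigma> = Abs_fps (\<lambda>n. poly (fps_nth (indec_gf \<sigma>) n) 1)"

definition F :: "nat \<Rightarrow> nat" where
  "F m = card (av_perms [1, 3, 4, 2] m)"

definition catalan :: "nat \<Rightarrow> real" where
  "catalan i = 1 / (real i + 1) * real ((2 * i) choose i)"

text \<open>The binomial series for \<open>(1 + c x)\<^sup>a\<close>.\<close>

definition binomial_series :: "real \<Rightarrow> real \<Rightarrow> real fps" where
  "binomial_series a c = fps_compose (fps_binomial a) (fps_const c * fps_X)"

lemma card_descents_less:
  assumes "\<pi> \<noteq> []"
  shows "card (descents \<pi>) < length \<pi>"
proof -
  have "descents \<pi> \<subseteq> {..<length \<pi> - 1}"
    by (auto simp: descents_def)
  then have "card (descents \<pi>) \<le> length \<pi> - 1"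
    using card_mono[of "{..<length \<pi> - 1}"] by fastforce
  with assms show ?thesis
    by (cases \<pi>) auto
qed

lemma indec_gf1_nth:
  "fps_nth (indec_gf1 \<sigma>) n = real (card {\<pi> \<in> av_perms \<sigma> n. indecomposable \<pi>})"
proof (cases "n = 0")
  case True
  then show ?thesis
    by (simp add: indec_gf1_def indec_gf_def av_perms_def indecomposable_def)
next
  case False
  let ?B = "{\<pi> \<in> av_perms \<sigma> n. indecomposable \<pi>}"
  have fin: "finite ?B"
    by (simp add: av_perms_def)
  have less: "card (descents \<pi>) < n" if "\<pi> \<in> ?B" for \<pi>
  proof -
    have "length \<pi> = n"
      using that length_finite_permutations_of_set[of \<pi> "{1..n}"] by (simp add: av_perms_def)
    with False card_descents_less[of \<pi>] show ?thesis
      by auto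
  qed
  have "card ?B = (\<Sum>i<n. card {\<pi> \<in> ?B. card (descents \<pi>) = i})"
    using sum_card_image less fin
      sum.group[of ?B "{..<n}" "\<lambda>\<pi>. card (descents \<pi>)" "\<lambda>_. 1::nat"]
    by (simp add: image_subset_iff)
  also have "\<dots> = (\<Sum>i<n. indec_num \<sigma> n i)"
    by (simp add: indec_num_def conj_assoc)
  finally show ?thesis
    using False by (simp add: indec_gf1_def indec_gf_def poly_sum poly_monom)
qed

end

theory Submission
  imports Defs
begin

text \<open>
  The first two identities come from writing a permutation as \<open>\<alpha> \<oplus> \<beta>\<close> with \<open>\<alpha>\<close> indecomposable: since
  2314 is \<open>231 \<oplus> 1\<close>, such a sum with \<open>\<beta>\<close> nonempty avoids 2314 iff \<open>\<alpha>\<close> avoids 231 and \<open>\<beta>\<close> avoids 2314.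
  The indecomposable 231-avoiders are those that start with their maximum, which gives \<open>I\<^sup>2\<^sup>3\<^sup>1 = x C(x)\<close>.

  The formula for 1342-avoiders is proved for its symmetric pattern 2314 (1342 and 3124 are
  reverse complements, 3124 and 2314 are inverses). A 2314-avoider is built by inserting successive
  maxima, and the places where the next maximum may go form a plane tree that evolves by a local
  rule. Splitting an insertion sequence according to the tree yields a functional equation with one
  catalytic variable, quadratic in the unknown series, which is solved by the parametrization
  \<open>x = s (1 - s) / (1 + s)\<^sup>2\<close>, under which the series of 2314-avoiders is \<open>(1 - s) (1 + s)\<^sup>2\<close>.
\<close>

section \<open>Series over insertion sequences\<close>

text \<open>2314 is a convenient representative because its largest letter comes last: whether a new
  maximum may enter at a place depends only on the prefix before it. The catalytic variable
  \<open>U\<close> marks the sites, but it is itself a power series in x, so one identity can be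
  specialised to \<open>U = 1\<close>, \<open>U = av_series\<close> and \<open>U = 1 + s\<close>
  within a single ring. The price is that \<open>U\<close> cannot be differentiated; difference
  quotients take over. The functional equation involves the unknown series at \<open>U\<close> and
  at A = \<open>av_series\<close>. Its instance \<open>U = 1\<close> expresses the second value
  through A. What remains is a quadratic equation with discriminant A * P(U), where P(U) = A (1 - U
  (1 + x))^2 + 4 x U^2 (1 - U). The parametrization comes from asking for a double root of P:
  eliminating A from P = 0 and dP/dU = 0 leaves (1 + x) U^2 - 3 U + 2 = 0, which for U = 1 + s reads
  x (1 + s)^2 = s (1 - s). Then 1 - U (1 + x) = -2 s / (1 + s), and P = 0 gives A = (1 - s) (1 +
  s)^2.\<close>

text \<open>
  The sites \<open>0, 1, \<dots>\<close> of a word \<open>\<pi>\<close> are the positions at which a new maximum can be inserted without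
  creating 2314, i.e. those with a 231-avoiding prefix. The entry of \<open>gs\<close> at a site \<open>p\<close> is the number
  of sites that survive to the right of \<open>p\<close> after such an insertion. This is the preorder code of a
  plane tree (each vertex is coded by its number of proper descendants): inserting at \<open>p\<close> deletes
  everything to the right of the subtree of \<open>p\<close>, and replaces this subtree, of size \<open>s\<close>, by a vertex
  with \<open>s\<close> leaves.
\<close>

definition advance :: "nat list \<Rightarrow> nat \<Rightarrow> nat list" where
  "advance gs p = map (\<lambda>j. if p \<le> j + gs ! j then p + 1 + gs ! p - j else gs ! j) [0..<Suc p]
     @ replicate (Suc (gs ! p)) 0"

text \<open>No subtree sticks out of the list, so an insertion to the right of such a code meets no
  ancestor inside it.\<close>

definition reach_closed :: "nat list \<Rightarrow> bool" where
  "reach_closed gs \<longleftrightarrow> (\<forall>j<length gs. j + gs ! j < length gs)"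

lemma length_advance [simp]: "length (advance gs p) = p + 2 + gs ! p"
  by (simp add: advance_def)

text \<open>Codes of plane forests \<open>T @ G\<close>: insertions in \<open>T\<close> delete \<open>G\<close>, insertions in \<open>G\<close> keep \<open>T\<close>.\<close>

lemma advance_append1: "p < length T \<Longrightarrow> advance (T @ G) p = advance T p"
  by (auto simp: advance_def nth_append)

lemma advance_append2:
  assumes "reach_closed T" "p < length G"
  shows "advance (T @ G) (length T + p) = T @ advance G p"
proof (rule nth_equalityI)
  show "length (advance (T @ G) (length T + p)) = length (T @ advance G p)"
    by simp
next
  fix i assume i: "i < length (advance (T @ G) (length T + p))"
  show "advance (T @ G) (length T + p) ! i = (T @ advance G p) ! i"
  proof (cases "i < length T")
    case True
    then have "i + T ! i < length T" using assms by (auto simp: reach_closed_def)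
    with True show ?thesis
      by (simp add: advance_def nth_append del: upt_Suc replicate_Suc)
  next
    case False
    then obtain d where d: "i = length T + d" using le_Suc_ex not_less by blast
    show ?thesis
      using i by (auto simp add: advance_def nth_append d simp del: upt_Suc replicate_Suc)
  qed
qed

text \<open>In \<open>length cs # cs\<close> every other vertex descends from the root, so this is a
  tree with the forest \<open>cs\<close> below its root. An insertion at the root turns all old
  vertices into leaves.\<close>

lemma advance_Node_0: "advance (length cs # cs) 0 = Suc (length cs) # replicate (Suc (length cs)) 0"
  by (simp add: advance_def)

text \<open>The root is an ancestor of every vertex, so its entry is merely adjusted to the new size
  of the forest below.\<close>

lemma advance_Node_Suc:
  assumes "p < length cs" 
  shows "advance (length cs # cs) (Suc p) = length (advance cs p) # advance cs p"
proof (rule nth_equalityI)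
  fix i assume i: "i < length (advance (length cs # cs) (Suc p))"
  show "advance (length cs # cs) (Suc p) ! i = (length (advance cs p) # advance cs p) ! i"
    using i assms
    by (cases i) (auto simp add: advance_def nth_append simp del: upt_Suc replicate_Suc)
qed simp

section \<open>Generating functions of insertion sequences\<close>

primrec play_level :: "nat \<Rightarrow> (nat list \<Rightarrow> real fps) \<Rightarrow> nat list \<Rightarrow> real fps" where
  "play_level 0 g gs = g gs"
| "play_level (Suc n) g gs = (\<Sum>p<length gs. play_level n g (advance gs p))"

text \<open>The sum over n of x^n times \<open>play_level n g gs\<close>. The weights
  \<open>g\<close> are themselves series in x, which is why each coefficient is a
  convolution.\<close>

definition play_sum :: "(nat list \<Rightarrow> real fps) \<Rightarrow> nat list \<Rightarrow> real fps" where
  "play_sum g gs = Abs_fps (\<lambda>N. \<Sum>n\<le>N. fps_nth (play_level n g gs) (N - n))"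

lemma play_sum_rec:
  "play_sum g gs = g gs + fps_X * (\<Sum>p<length gs. play_sum g (advance gs p))"
proof (rule fps_ext)
  fix N
  show "fps_nth (play_sum g gs) N =
      fps_nth (g gs + fps_X * (\<Sum>p<length gs. play_sum g (advance gs p))) N"
  proof (cases N)
    case (Suc m)
    have "(\<Sum>n\<le>m. \<Sum>p<length gs. fps_nth (play_level n g (advance gs p)) (m - n)) =
        (\<Sum>p<length gs. \<Sum>n\<le>m. fps_nth (play_level n g (advance gs p)) (m - n))"
      by (rule sum.swap)
    with Suc show ?thesis
      by (simp add: play_sum_def sum.atMost_Suc_shift fps_sum_nth del: sum.atMost_Suc)
  qed (simp add: play_sum_def)
qed

lemma sum_lessThan_add:
  fixes f :: "nat \<Rightarrow> 'a :: comm_monoid_add"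
  shows "(\<Sum>p<m + n. f p) = (\<Sum>p<m. f p) + (\<Sum>p<n. f (m + p))"
  by (induction n) (simp_all add: add.assoc)

text \<open>The uniqueness principle behind the identities below: because of the factor x, each
  coefficient is determined by lower coefficients of other members of the family. It is applied to
  the difference of the two sides, in place of an explicit splitting of insertion sequences.\<close>

lemma fps_family_zero:
  fixes D :: "'a \<Rightarrow> real fps"
  assumes "\<And>a. D a = fps_X * (\<Sum>i\<in>I a. D (nx a i))"
  shows "D a = 0"
proof (rule fps_ext)
  fix n
  show "fps_nth (D a) n = fps_nth 0 n"
  proof (induction n arbitrary: a)
    case 0
    then show ?case by (subst assms) simp
  next
    case (Suc n)
    then show ?case by (subst assms) (simp add: fps_sum_nth)
  qed
qed

lemma play_sum_linear:
  "play_sum (\<lambda>gs. c * g gs + d * h gs) gs = c * play_sum g gs + d * play_sum h gs"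
proof -
  define D where "D gs = play_sum (\<lambda>gs. c * g gs + d * h gs) gs -
    (c * play_sum g gs + d * play_sum h gs)" for gs
  have "D gs = fps_X * (\<Sum>p\<in>{..<length gs}. D (advance gs p))" for gs
    unfolding D_def play_sum_rec[of _ gs]
    by (simp add: algebra_simps sum.distrib sum_subtractf sum_distrib_left)
  from fps_family_zero[OF this] show ?thesis by (simp add: D_def)
qed

text \<open>Insertion sequences counted by length (in x) and by the number of sites at the end (in
  \<open>U\<close>); \<open>U = 1\<close> forgets the sites.\<close>

definition size_gf :: "real fps \<Rightarrow> nat list \<Rightarrow> real fps" where
  "size_gf U = play_sum (\<lambda>gs. U ^ length gs)"

lemma size_gf_rec: "size_gf U gs = U ^ length gs + fps_X * (\<Sum>p<length gs. size_gf U (advance gs p))"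
  unfolding size_gf_def by (rule play_sum_rec)

text \<open>While all insertions fall into \<open>G\<close>, the vertices of \<open>T\<close>
  survive. The first insertion in \<open>T\<close> deletes \<open>G\<close>, so before it only the
  number of insertions in \<open>G\<close> matters (\<open>size_gf 1 G\<close>), and from it on a
  nonempty insertion sequence in \<open>T\<close> remains
  (\<open>size_gf U T - U ^ length T\<close>).\<close>

lemma size_gf_append:
  assumes "reach_closed T"
  shows "size_gf U (T @ G) = U ^ length T * size_gf U G + (size_gf U T - U ^ length T) * size_gf 1 G"
proof -
  define B where "B = size_gf U T - U ^ length T"
  define D where "D G = size_gf U (T @ G) - (U ^ length T * size_gf U G + B * size_gf 1 G)" for G
  have B: "B = fps_X * (\<Sum>p<length T. size_gf U (advance T p))"
    unfolding B_def by (subst size_gf_rec) simp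
  have "D G = fps_X * (\<Sum>p\<in>{..<length G}. D (advance G p))" for G
  proof -
    have "(\<Sum>p<length (T @ G). size_gf U (advance (T @ G) p)) =
        (\<Sum>p<length T. size_gf U (advance (T @ G) p)) + (\<Sum>p<length G. size_gf U (advance (T @ G) (length T + p)))"
      by (simp add: sum_lessThan_add)
    also have "\<dots> = (\<Sum>p<length T. size_gf U (advance T p)) + (\<Sum>p<length G. size_gf U (T @ advance G p))"
      using assms by (simp add: advance_append1 advance_append2)
    finally have "size_gf U (T @ G) = U ^ (length T + length G) + B +
        fps_X * (\<Sum>p<length G. size_gf U (T @ advance G p))"
      by (subst size_gf_rec) (simp add: B algebra_simps)
    moreover have "D G = size_gf U (T @ G) - (U ^ length T * (U ^ length G + fps_X * (\<Sum>p<length G. size_gf U (advance G p)))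
       + B * (1 + fps_X * (\<Sum>p<length G. size_gf 1 (advance G p))))"
      unfolding D_def using size_gf_rec[of U G] size_gf_rec[of 1 G] by simp
    ultimately show ?thesis
      unfolding D_def
      by (simp add: algebra_simps power_add sum.distrib sum_subtractf sum_distrib_left)
  qed
  from fps_family_zero[OF this] show ?thesis by (simp add: D_def B_def)
qed

text \<open>Insertion sequences are split at the last insertion in the root of the tree.\<close>

lemma size_gf_node:
  "size_gf U (length cs # cs) = U * size_gf U cs +
     fps_X * U * play_sum (\<lambda>gs. size_gf U (replicate (length gs) 0)) (length cs # cs)"
proof -
  define h where "h = (\<lambda>gs :: nat list. size_gf U (replicate (length gs) 0))"
  define D where "D cs = size_gf U (length cs # cs) - (U * size_gf U cs + fps_X * U * play_sum h (length cs # cs))"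
    for cs
  \<comment> \<open>The forest below the root after an insertion: site 0 is the root, and site
    \<open>Suc p\<close> is the vertex \<open>p\<close> of \<open>cs\<close>.\<close>
  define nx :: "nat list \<Rightarrow> nat \<Rightarrow> nat list" where
    "nx cs p = (case p of 0 \<Rightarrow> replicate (Suc (length cs)) 0 | Suc p \<Rightarrow> advance cs p)" for cs p
  have "D cs = fps_X * (\<Sum>p\<in>{..<Suc (length cs)}. D (nx cs p))" for cs
  proof -
    have size_gf: "size_gf U (length cs # cs) = U ^ Suc (length cs) +
        fps_X * (\<Sum>p<Suc (length cs). size_gf U (length (nx cs p) # nx cs p))"
      by (subst size_gf_rec)
         (simp add: sum.lessThan_Suc_shift advance_Node_0 advance_Node_Suc nx_def del: sum.lessThan_Suc)
    have P: "play_sum h (length cs # cs) = size_gf U (replicate (Suc (length cs)) 0) +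
        fps_X * (\<Sum>p<Suc (length cs). play_sum h (length (nx cs p) # nx cs p))"
      by (subst play_sum_rec)
         (simp add: sum.lessThan_Suc_shift advance_Node_0 advance_Node_Suc nx_def h_def
           del: sum.lessThan_Suc)
    \<comment> \<open>The recursion of \<open>size_gf U cs\<close> covers the insertions below the
      root, so only the root term of the sum is left over.\<close>
    have "fps_X * (\<Sum>p<Suc (length cs). size_gf U (nx cs p)) =
        fps_X * size_gf U (replicate (Suc (length cs)) 0) + (size_gf U cs - U ^ length cs)"
      by (subst (3) size_gf_rec)
         (simp add: sum.lessThan_Suc_shift nx_def algebra_simps del: sum.lessThan_Suc)
    then have "U * (fps_X * (\<Sum>p<Suc (length cs). size_gf U (nx cs p))) =
        U * (fps_X * size_gf U (replicate (Suc (length cs)) 0) + (size_gf U cs - U ^ length cs))"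
      by simp
    then show ?thesis
      unfolding D_def size_gf P
      by (simp add: algebra_simps sum.distrib sum_subtractf sum_distrib_left del: sum.lessThan_Suc)
  qed
  from fps_family_zero[OF this] show ?thesis by (simp add: D_def h_def)
qed

section \<open>The functional equation in one catalytic variable\<close>

definition av_series :: "real fps" where "av_series = size_gf 1 [0]"
text \<open>\<open>[0]\<close> is the code of the empty permutation, and \<open>[1, 0]\<close> is
  the code after its only possible insertion: a root with one leaf.\<close>

definition node_series :: "real fps \<Rightarrow> real fps" where "node_series U = size_gf U [1, 0]"

lemma size_gf_leaf: "size_gf U [0] = U + fps_X * node_series U"
  by (subst size_gf_rec) (simp add: advance_def node_series_def)

lemma av_series_eq: "av_series = 1 + fps_X * node_series 1"
  by (simp add: av_series_def size_gf_leaf)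

lemma size_gf_Nil: "size_gf U [] = 1"
  by (subst size_gf_rec) simp

lemma size_gf_leaves_Suc:
  "size_gf U (replicate (Suc m) 0) = U * size_gf U (replicate m 0) + fps_X * node_series U * size_gf 1 (replicate m 0)"
  using size_gf_append[of "[0]" U "replicate m 0"] by (simp add: size_gf_leaf reach_closed_def)

lemma size_gf_1_leaves: "size_gf 1 (replicate m 0) = av_series ^ m"
proof (induction m)
  case (Suc m)
  then show ?case
    by (simp only: size_gf_leaves_Suc) (simp add: av_series_eq algebra_simps)
qed (simp add: size_gf_Nil)

text \<open>The solution of the linear recurrence in \<open>m\<close>, a geometric sum. It is stated
  times \<open>U - av_series\<close> rather than with a quotient, so that no condition on
  \<open>U\<close> arises.\<close>

lemma size_gf_leaves:
  "(U - av_series) * size_gf U (replicate m 0) = (U - av_series) * U ^ m + fps_X * node_series U * (U ^ m - av_series ^ m)"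
proof (induction m)
  case (Suc m)
  have "(U - av_series) * size_gf U (replicate (Suc m) 0) =
      U * ((U - av_series) * size_gf U (replicate m 0)) + (U - av_series) * fps_X * node_series U * av_series ^ m"
    by (simp only: size_gf_leaves_Suc size_gf_1_leaves) (simp add: algebra_simps)
  then show ?case unfolding Suc.IH by (simp add: algebra_simps)
qed (simp add: size_gf_Nil)

text \<open>By \<open>size_gf_leaves\<close>, the weight that follows a last insertion in the root
  is a combination of \<open>U ^ length gs\<close> and \<open>av_series ^ length gs\<close>. Summing
  over the preceding insertions therefore returns \<open>node_series\<close> at these two
  arguments.\<close>

lemma node_series_eq:
  "(U - av_series) * node_series U = U * ((U - av_series) * (U + fps_X * node_series U) +
     fps_X * ((U - av_series) * node_series U + fps_X * node_series U * (node_series U - node_series av_series)))"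
proof -
  let ?S = "play_sum (\<lambda>gs. size_gf U (replicate (length gs) 0)) [1, 0]"
  \<comment> \<open>The summand \<open>0 * 0\<close> supplies the shape of
    \<open>play_sum_linear\<close>, which here only pulls out a factor.\<close>
  have "(U - av_series) * ?S = play_sum (\<lambda>gs. (U - av_series) * size_gf U (replicate (length gs) 0) + 0 * 0) [1, 0]"
    by (subst play_sum_linear) simp
  also have "\<dots> = play_sum (\<lambda>gs. (U - av_series + fps_X * node_series U) * U ^ length gs +
      (- fps_X * node_series U) * av_series ^ length gs) [1, 0]"
    by (simp only: size_gf_leaves mult_zero_left add_0_right) (simp add: algebra_simps)
  also have "\<dots> = (U - av_series + fps_X * node_series U) * node_series U + (- fps_X * node_series U) * node_series av_series"
    by (subst play_sum_linear) (simp add: node_series_def size_gf_def)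
  finally have S: "(U - av_series) * ?S = (U - av_series + fps_X * node_series U) * node_series U + (- fps_X * node_series U) * node_series av_series" .
  have "node_series U = U * (U + fps_X * node_series U) + fps_X * U * ?S"
    using size_gf_node[of U "[0]"] by (simp add: node_series_def size_gf_leaf)
  then have "(U - av_series) * node_series U = (U - av_series) * (U * (U + fps_X * node_series U)) + fps_X * U * ((U - av_series) * ?S)"
    by (metis (no_types, lifting) distrib_left mult.left_commute)
  then show ?thesis unfolding S by (simp add: algebra_simps)
qed

lemma node_series_nth_0: "fps_nth (node_series U) 0 = fps_nth U 0 ^ 2"
  unfolding node_series_def by (subst size_gf_rec) (simp add: fps_nth_power_0 power2_eq_square)

text \<open>The instance \<open>U = 1\<close> of the functional equation: there
  \<open>U - av_series\<close> is \<open>- fps_X * node_series 1\<close>, so this nonzero factor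
  occurs in every term and cancels.\<close>

lemma node_series_Z: "fps_X ^ 2 * node_series av_series = av_series * (1 - fps_X) - 1"
proof -
  have "fps_nth (node_series 1) 0 \<noteq> 0" by (simp add: node_series_nth_0)
  then have ne: "fps_X * node_series 1 \<noteq> 0" by auto
  have "fps_X * node_series 1 * (fps_X ^ 2 * node_series av_series) = fps_X * node_series 1 * (av_series * (1 - fps_X) - 1)"
    using node_series_eq[of 1] av_series_eq by algebra
  with ne show ?thesis by (metis mult_left_cancel)
qed

text \<open>Multiplied by x, and with the value from \<open>node_series_Z\<close>, the functional
  equation is quadratic in \<open>N = fps_X * node_series U\<close>. \<open>Y\<close> completes the
  square.\<close>

lemma node_series_quadratic:
  fixes U
  defines "Y \<equiv> 2 * fps_X * U * (fps_X * node_series U) + 2 * fps_X * U ^ 2 + av_series * (1 - U * (1 + fps_X))"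
  shows "Y ^ 2 = av_series * (av_series * (1 - U * (1 + fps_X)) ^ 2 + 4 * fps_X * U ^ 2 * (1 - U))"
proof -
  define N where "N = fps_X * node_series U"
  define b where "b = 2 * fps_X * U ^ 2 + av_series * (1 - U * (1 + fps_X))"
  have "fps_X * U * N ^ 2 + b * N + fps_X * U ^ 2 * (U - av_series) =
      fps_X * (U * ((U - av_series) * (U + fps_X * node_series U) +
        fps_X * ((U - av_series) * node_series U + fps_X * node_series U * (node_series U - node_series av_series))) - (U - av_series) * node_series U) +
      U * N * (fps_X ^ 2 * node_series av_series - (av_series * (1 - fps_X) - 1))"
    unfolding N_def b_def by (simp add: algebra_simps power2_eq_square)
  also have "\<dots> = 0"
    unfolding node_series_eq[of U, symmetric] node_series_Z by simp
  finally have "fps_X * U * N ^ 2 + b * N + fps_X * U ^ 2 * (U - av_series) = 0" .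
  then have "(2 * fps_X * U * N + b) ^ 2 = b ^ 2 - 4 * fps_X ^ 2 * U ^ 3 * (U - av_series)"
    by algebra
  also have "\<dots> = av_series * (av_series * (1 - U * (1 + fps_X)) ^ 2 + 4 * fps_X * U ^ 2 * (1 - U))"
    unfolding b_def by algebra
  finally show ?thesis by (simp add: Y_def N_def b_def add.assoc)
qed

text \<open>The substitute for a derivative in \<open>U\<close>; it is inherited from the
  divisibility of \<open>U ^ n - V ^ n\<close> by \<open>U - V\<close>.\<close>

lemma node_series_lipschitz: "\<exists>Q. node_series U - node_series V = (U - V) * Q"
proof -
  have "node_series U - node_series V = play_sum (\<lambda>gs. 1 * U ^ length gs + (- 1) * V ^ length gs) [1, 0]"
    by (subst play_sum_linear) (simp add: node_series_def size_gf_def)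
  also have "(\<lambda>gs. 1 * U ^ length gs + (- 1) * V ^ length gs) =
      (\<lambda>gs :: nat list. (U - V) * (\<Sum>i<length gs. V ^ (length gs - Suc i) * U ^ i) + 0 * 0)"
    by (rule ext) (simp add: power_diff_sumr2)
  also have "play_sum \<dots> [1, 0] =
      (U - V) * play_sum (\<lambda>gs. \<Sum>i<length gs. V ^ (length gs - Suc i) * U ^ i) [1, 0]"
    by (subst play_sum_linear) simp
  finally show ?thesis by blast
qed

lemma av_series_nth_0: "fps_nth av_series 0 = 1"
  by (simp add: av_series_eq)

lemma av_series_nth_1: "fps_nth av_series 1 = 1"
  by (simp add: av_series_eq node_series_nth_0)

text \<open>
  This replaces the double root argument of the quadratic method. The discriminant \<open>av_series * P U\<close>
  of the quadratic equation is a square for every \<open>U\<close>. If \<open>P\<close> did not have the double root \<open>t = 1 + s\<close>, then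
  the discriminants at \<open>t\<close> and at \<open>t + x\<^sup>K\<close> would force the square roots to have incompatible orders.
\<close>

lemma av_series_param:
  assumes s: "fps_X * (1 + s) ^ 2 = s * (1 - s)" and s0: "fps_nth s 0 = 0"
  shows "av_series = (1 - s) * (1 + s) ^ 2"
proof (rule ccontr)
  assume neq: "av_series \<noteq> (1 - s) * (1 + s) ^ 2"
  define D where "D = av_series - (1 - s) * (1 + s) ^ 2"
  define d where "d = subdegree D"
  define t where "t = 1 + s"
  \<comment> \<open>The exponent is just above \<open>d + 1\<close>, the order of the term
    \<open>L\<close> below, so that multiples of \<open>h\<close> cannot disturb it.\<close>
  define h :: "real fps" where "h = fps_X ^ (d + 2)"
  define Y where
    "Y U = 2 * fps_X * U * (fps_X * node_series U) + 2 * fps_X * U ^ 2 + av_series * (1 - U * (1 + fps_X))" for U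
  define P where "P U = av_series * (1 - U * (1 + fps_X)) ^ 2 + 4 * fps_X * U ^ 2 * (1 - U)" for U
  have Y: "Y U ^ 2 = av_series * P U" for U
    using node_series_quadratic[of U] by (simp add: Y_def P_def)
  have D0: "D \<noteq> 0" "fps_nth D 0 = 0"
    using neq by (simp_all add: D_def av_series_nth_0 s0 fps_nth_power_0)
  have s': "fps_X * t ^ 2 = s * (1 - s)" using s by (simp add: t_def)
  have sdZ: "av_series \<noteq> 0" "subdegree av_series = 0"
    using av_series_nth_0 by (auto simp: subdegree_eq_0_iff)
  have sdt: "t \<noteq> 0" "subdegree t = 0"
    by (auto simp: t_def s0 subdegree_eq_0_iff fps_eq_iff intro!: exI[of _ 0])
  have "1 - s \<noteq> 0" "subdegree (1 - s) = 0"
    by (auto simp: s0 subdegree_eq_0_iff fps_eq_iff intro!: exI[of _ 0])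
  moreover have "s \<noteq> 0" using s' sdt by auto
  ultimately have sds: "s \<noteq> 0" "subdegree s = 1"
    using arg_cong[OF s', of subdegree] sdt by auto
  \<comment> \<open>Since 1 - t (1 + x) = -2 s / t, \<open>P t\<close> is a multiple of
    \<open>D\<close>. This makes the order of \<open>Y t\<close> equal to (d + 2) / 2.\<close>
  have Y0: "t ^ 2 * Y t ^ 2 = 4 * s ^ 2 * av_series * D"
    unfolding Y P_def D_def using s' unfolding t_def by algebra
  obtain Q' where Q': "node_series (t + h) - node_series t = h * Q'"
    using node_series_lipschitz[of "t + h" t] by auto
  \<comment> \<open>The difference quotient of \<open>Y\<close> between \<open>t\<close> and
    \<open>t + h\<close>; its constant term -1 makes it a unit.\<close>
  define Q where "Q = 2 * fps_X * (fps_X * (node_series (t + h) + t * Q')) + 2 * fps_X * (2 * t + h) - av_series * (1 + fps_X)"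
  have Q: "Y (t + h) = Y t + h * Q"
    using Q' unfolding Y_def Q_def by algebra
  have Q0: "fps_nth Q 0 = - 1"
    by (simp add: Q_def av_series_nth_0 mult.assoc)
  then have sdQ: "Q \<noteq> 0" "subdegree Q = 0"
    by (auto simp: subdegree_eq_0_iff)
  \<comment> \<open>Taylor expansion of the cubic \<open>P\<close> at \<open>t\<close>:
    \<open>P'\<close> is its derivative there, and \<open>E\<close> is the remainder divided by
    \<open>h ^ 2\<close>. Like \<open>P t\<close>, \<open>P'\<close> is a multiple of
    \<open>D\<close> up to the factor \<open>t\<close>.\<close>
  define E where "E = av_series * (1 + fps_X) ^ 2 + 4 * fps_X * (1 - 3 * t - h)"
  define P' where "P' = - 2 * av_series * (1 + fps_X) * (1 - t * (1 + fps_X)) + 8 * fps_X * t - 12 * fps_X * t ^ 2"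
  have "P (t + h) - P t = h * (P' + h * E)"
    unfolding P_def P'_def E_def by algebra
  then have "h * (Q * (2 * Y t + h * Q)) = h * (av_series * (P' + h * E))"
    using Y[of t] Y[of "t + h"] unfolding Q by algebra
  then have "Q * (2 * Y t + h * Q) = av_series * (P' + h * E)"
    by (simp add: h_def)
  moreover have P': "t * P' = 4 * s * (1 + fps_X) * D"
    unfolding P'_def D_def using s' unfolding t_def by algebra
  \<comment> \<open>The first term on the right has order \<open>d + 1\<close> and the second at
    least \<open>d + 2\<close>, so \<open>Y t\<close> has order \<open>d + 1\<close>, in conflict
    with \<open>Y0\<close> unless \<open>d = 0\<close>.\<close>
  ultimately have main: "2 * Q * t * Y t = 4 * s * (1 + fps_X) * av_series * D + h * (t * av_series * E - t * Q ^ 2)"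
    by algebra
  define L where "L = 4 * s * (1 + fps_X) * av_series * D"
  have X1: "(1 + fps_X :: real fps) \<noteq> 0" "subdegree (1 + fps_X :: real fps) = 0"
    by (auto simp: subdegree_eq_0_iff fps_eq_iff intro!: exI[of _ 0])
  have L: "L \<noteq> 0" "subdegree L = d + 1"
    using D0 sds sdZ X1 by (simp_all add: L_def d_def)
  have h: "fps_nth (h * R) i = 0" if "i < d + 2" for R i
    using that by (simp only: h_def fps_X_power_mult_nth) simp
  have "subdegree (2 * Q * t * Y t) = d + 1"
  proof (rule subdegreeI)
    show "fps_nth (2 * Q * t * Y t) (d + 1) \<noteq> 0"
      using nth_subdegree_nonzero[OF L(1)] unfolding main L_def[symmetric] L(2)
      by (simp add: h)
    show "fps_nth (2 * Q * t * Y t) i = 0" if "i < d + 1" for i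
      using nth_less_subdegree_zero[of i L] that unfolding main L_def[symmetric] L(2)
      by (simp add: h)
  qed
  moreover have "Y t \<noteq> 0"
    using Y0 sds sdZ D0 by auto
  ultimately have "subdegree (Y t) = d + 1"
    using sdQ sdt by simp
  moreover have "2 * subdegree (Y t) = 2 + d"
    using arg_cong[OF Y0, of subdegree] sds sdZ D0 sdt \<open>Y t \<noteq> 0\<close> by (simp add: d_def)
  ultimately have "d = 0" by simp
  with D0 show False by (simp add: d_def subdegree_eq_0_iff)
qed

text \<open>The parameter equation is (1 + x) s^2 - (1 - 2 x) s + x = 0, with discriminant 1 - 8 x.
  In terms of r, its root without constant term is s = (1 - r) / (3 + r), so 1 + s = 4 / (3 + r) and
  1 - s = 2 (1 + r) / (3 + r). The denominator of the closed form equals (3 + r)^3 (1 - r) /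
  8.\<close>

lemma av_series_closed_form:
  assumes r: "r ^ 2 = 1 - 8 * fps_X" and r0: "fps_nth r 0 = 1"
  shows "av_series * (1 + 20 * fps_X - 8 * fps_X ^ 2 - r ^ 3) = 32 * fps_X"
proof -
  define v where "v = inverse (3 + r)"
  have v: "(3 + r) * v = 1"
    unfolding v_def by (rule inverse_mult_eq_1') (simp add: r0)
  define s where "s = (1 - r) * v"
  \<comment> \<open>The factor 8 clears the denominator in x = (1 - r^2) / 8.\<close>
  have "8 * (fps_X * (1 + s) ^ 2) = 8 * (s * (1 - s))"
    unfolding s_def using v r by algebra
  then have "fps_X * (1 + s) ^ 2 = s * (1 - s)"
    by simp
  moreover have "fps_nth s 0 = 0" by (simp add: s_def r0)
  ultimately have "av_series = (1 - s) * (1 + s) ^ 2" by (rule av_series_param)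
  also have "\<dots> = 32 * (1 + r) * v ^ 3"
    unfolding s_def using v by algebra
  finally have "8 * (av_series * (1 + 20 * fps_X - 8 * fps_X ^ 2 - r ^ 3)) = 8 * (32 * fps_X)"
    using v r by algebra
  then show ?thesis
    by (metis mult_left_cancel zero_neq_numeral)
qed

section \<open>Insertion of maxima into 2314-avoiding permutations\<close>

definition has231 :: "nat list \<Rightarrow> nat \<Rightarrow> bool" where
  "has231 xs q \<longleftrightarrow> (\<exists>i j l. i < j \<and> j < l \<and> l < q \<and> xs ! l < xs ! i \<and> xs ! i < xs ! j)"

definition has2314 :: "nat list \<Rightarrow> nat \<Rightarrow> bool" where
  "has2314 xs q \<longleftrightarrow> (\<exists>i j l m. i < j \<and> j < l \<and> l < m \<and> m < q \<and>
     xs ! l < xs ! i \<and> xs ! i < xs ! j \<and> xs ! j < xs ! m)"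

lemma has231_cong:
  assumes "\<And>i. i < q \<Longrightarrow> xs ! i = ys ! i"
  shows "has231 xs q \<longleftrightarrow> has231 ys q"
proof -
  have "has231 ys q" if "has231 xs q" "\<And>i. i < q \<Longrightarrow> xs ! i = ys ! i" for xs ys
  proof -
    from that(1) obtain i j l where
      "i < j" "j < l" "l < q" "xs ! l < xs ! i" "xs ! i < xs ! j"
      by (auto simp: has231_def)
    then show ?thesis
      unfolding has231_def using that(2)
      by (intro exI[of _ i] exI[of _ j] exI[of _ l]) simp
  qed
  with assms show ?thesis by metis
qed

definition insert_at :: "nat \<Rightarrow> nat \<Rightarrow> nat list \<Rightarrow> nat list" where
  "insert_at p N xs = take p xs @ N # drop p xs"

lemma length_insert_at [simp]: "length (insert_at p N xs) = Suc (length xs)"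
  by (simp add: insert_at_def)

lemma nth_insert_at:
  assumes "p \<le> length xs"
  shows "insert_at p N xs ! i = (if i < p then xs ! i else if i = p then N else xs ! (i - 1))"
  using assms by (auto simp: insert_at_def nth_append nth_Cons' min_def)

context
  fixes xs :: "nat list" and N p :: nat
  assumes less: "\<And>i. i < length xs \<Longrightarrow> xs ! i < N" and p: "p \<le> length xs"
begin

private definition "dn x = (if x < p then x else x - 1)" for x :: nat
private definition "up x = (if x < p then x else x + 1)" for x :: nat

lemma dn_mono: "x < y \<Longrightarrow> x \<noteq> p \<Longrightarrow> y \<noteq> p \<Longrightarrow> dn x < dn y"
  and dn_less: "x < Suc q \<Longrightarrow> x \<noteq> p \<Longrightarrow> p \<le> q \<Longrightarrow> dn x < q"
  and up_mono: "x < y \<Longrightarrow> up x < up y"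
  and up_less: "x < q \<Longrightarrow> up x < Suc q"
  by (auto simp: dn_def up_def)

lemma nth_insert_at_dn: "x \<noteq> p \<Longrightarrow> insert_at p N xs ! x = xs ! dn x"
  and nth_insert_at_up: "insert_at p N xs ! up x = xs ! x"
  by (auto simp: dn_def up_def nth_insert_at[OF p])

lemma insert_at_le: "x < Suc (length xs) \<Longrightarrow> insert_at p N xs ! x \<le> N"
proof -
  assume x: "x < Suc (length xs)"
  consider "x < p" "x < length xs" | "x = p" | "p < x" "x - 1 < length xs"
    using p x by linarith
  then show ?thesis
    using less[of x] less[of "x - 1"] p by cases (auto simp: nth_insert_at)
qed

text \<open>A maximum can only be the 3 of a 231, and then the 2 and the 1 form an inversion across
  \<open>p\<close>.\<close>

lemma has231_insert_at:
  assumes q: "p \<le> q" "q \<le> length xs"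
  shows "has231 (insert_at p N xs) (Suc q) \<longleftrightarrow>
    has231 xs q \<or> (\<exists>i<p. \<exists>j. p \<le> j \<and> j < q \<and> xs ! j < xs ! i)"
proof
  assume "has231 (insert_at p N xs) (Suc q)"
  then obtain i j l where *: "i < j" "j < l" "l < Suc q" "insert_at p N xs ! l < insert_at p N xs ! i"
      "insert_at p N xs ! i < insert_at p N xs ! j"
    by (auto simp: has231_def)
  have "i \<noteq> p" "l \<noteq> p"
    using * insert_at_le[of i] insert_at_le[of j] q by (auto simp: nth_insert_at[OF p])
  show "has231 xs q \<or> (\<exists>i<p. \<exists>j. p \<le> j \<and> j < q \<and> xs ! j < xs ! i)"
  proof (cases "j = p")
    case True
    with * have "i < p" "p \<le> l - 1" "l - 1 < q" "xs ! (l - 1) < xs ! i"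
      by (auto simp: nth_insert_at[OF p] split: if_splits)
    then show ?thesis by blast
  next
    case False
    with * \<open>i \<noteq> p\<close> \<open>l \<noteq> p\<close> q have "has231 xs q"
      unfolding has231_def
      by (intro exI[of _ "dn i"] exI[of _ "dn j"] exI[of _ "dn l"])
         (simp add: nth_insert_at_dn dn_mono dn_less)
    then show ?thesis ..
  qed
next
  assume "has231 xs q \<or> (\<exists>i<p. \<exists>j. p \<le> j \<and> j < q \<and> xs ! j < xs ! i)"
  then show "has231 (insert_at p N xs) (Suc q)"
  proof (elim disjE exE conjE)
    assume "has231 xs q"
    then obtain i j l where "i < j" "j < l" "l < q" "xs ! l < xs ! i" "xs ! i < xs ! j"
      by (auto simp: has231_def)
    then show ?thesis
      unfolding has231_def
      by (intro exI[of _ "up i"] exI[of _ "up j"] exI[of _ "up l"])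
         (simp add: nth_insert_at_up up_mono up_less)
  next
    fix i j assume "i < p" "p \<le> j" "j < q" "xs ! j < xs ! i"
    then show ?thesis
      unfolding has231_def using p q less[of i]
      by (intro exI[of _ i] exI[of _ p] exI[of _ "Suc j"]) (simp add: nth_insert_at)
  qed
qed

text \<open>A maximum can only be the 4 of a 2314, and then a 231 precedes it.\<close>

lemma has2314_insert_at:
  "has2314 (insert_at p N xs) (Suc (length xs)) \<longleftrightarrow> has2314 xs (length xs) \<or> has231 xs p"
proof
  assume "has2314 (insert_at p N xs) (Suc (length xs))"
  then obtain i j l m where *: "i < j" "j < l" "l < m" "m < Suc (length xs)"
      "insert_at p N xs ! l < insert_at p N xs ! i" "insert_at p N xs ! i < insert_at p N xs ! j"
      "insert_at p N xs ! j < insert_at p N xs ! m"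
    by (auto simp: has2314_def)
  have ne: "i \<noteq> p" "l \<noteq> p" "j \<noteq> p"
    using * insert_at_le[of i] insert_at_le[of j] insert_at_le[of m] by (auto simp: nth_insert_at[OF p])
  show "has2314 xs (length xs) \<or> has231 xs p"
  proof (cases "m = p")
    case True
    with * have "has231 xs p"
      unfolding has231_def
      by (intro exI[of _ i] exI[of _ j] exI[of _ l]) (auto simp: nth_insert_at[OF p])
    then show ?thesis ..
  next
    case False
    with * ne p have "has2314 xs (length xs)"
      unfolding has2314_def
      by (intro exI[of _ "dn i"] exI[of _ "dn j"] exI[of _ "dn l"] exI[of _ "dn m"])
         (simp add: nth_insert_at_dn dn_mono dn_less)
    then show ?thesis ..
  qed
next
  assume "has2314 xs (length xs) \<or> has231 xs p"
  then show "has2314 (insert_at p N xs) (Suc (length xs))"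
  proof
    assume "has2314 xs (length xs)"
    then obtain i j l m where "i < j" "j < l" "l < m" "m < length xs"
        "xs ! l < xs ! i" "xs ! i < xs ! j" "xs ! j < xs ! m"
      by (auto simp: has2314_def)
    then show ?thesis
      unfolding has2314_def
      by (intro exI[of _ "up i"] exI[of _ "up j"] exI[of _ "up l"] exI[of _ "up m"])
         (simp add: nth_insert_at_up up_mono up_less)
  next
    assume "has231 xs p"
    then obtain i j l where "i < j" "j < l" "l < p" "xs ! l < xs ! i" "xs ! i < xs ! j"
      by (auto simp: has231_def)
    then show ?thesis
      unfolding has2314_def using p less[of j]
      by (intro exI[of _ i] exI[of _ j] exI[of _ l] exI[of _ p]) (simp add: nth_insert_at)
  qed
qed

end

text \<open>By \<open>has231_insert_at\<close>, an old site \<open>q \<ge> p\<close> survives an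
  insertion at \<open>p\<close> iff no inversion leads from before \<open>p\<close> into the
  positions from \<open>p\<close> to \<open>q - 1\<close>. Such \<open>q\<close> form an interval,
  and \<open>p + gs ! p\<close> is its right end.\<close>

definition is_reach_list :: "nat list \<Rightarrow> nat list \<Rightarrow> bool" where
  "is_reach_list xs gs \<longleftrightarrow>
     (\<forall>q. q < length gs \<longleftrightarrow> q \<le> length xs \<and> \<not> has231 xs q) \<and>
     (\<forall>p<length gs. \<forall>q\<ge>p. q \<le> p + gs ! p \<longleftrightarrow>
        q < length gs \<and> (\<forall>i<p. \<forall>j. p \<le> j \<and> j < q \<longrightarrow> xs ! i < xs ! j))"

lemma is_reach_list_unique:
  assumes "is_reach_list xs gs" "is_reach_list xs hs"
  shows "gs = hs"
proof (rule nth_equalityI)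
  have "q < length gs \<longleftrightarrow> q < length hs" for q
    using assms by (simp add: is_reach_list_def)
  from this[of "length gs"] this[of "length hs"] show len: "length gs = length hs"
    by auto
  fix p assume p: "p < length gs"
  have "q \<le> p + gs ! p \<longleftrightarrow> q \<le> p + hs ! p" if "p \<le> q" for q
    using assms p len that by (simp add: is_reach_list_def)
  from this[of "p + gs ! p"] this[of "p + hs ! p"] show "gs ! p = hs ! p"
    by auto
qed

lemma is_reach_list_Nil: "is_reach_list [] [0]"
  by (auto simp: is_reach_list_def has231_def)

text \<open>The tree rule holds for permutations. A site right of the new maximum reaches only
  itself, since the maximum exceeds whatever comes next. A site whose reach includes
  \<open>p\<close> now reaches the last site: the entries up to \<open>p\<close>, the maximum, and
  the entries in the reach of \<open>p\<close> all lie above its prefix. The reach of any other site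
  up to \<open>p\<close> ends before \<open>p\<close> and does not change.\<close>

lemma is_reach_list_insert_at:
  assumes dist: "distinct xs" and less: "\<And>i. i < length xs \<Longrightarrow> xs ! i < N"
    and st: "is_reach_list xs gs" and p: "p < length gs"
  shows "is_reach_list (insert_at p N xs) (advance gs p)"
proof -
  have st1: "q < length gs \<longleftrightarrow> q \<le> length xs \<and> \<not> has231 xs q" for q
    using st by (simp add: is_reach_list_def)
  have st2: "q \<le> P + gs ! P \<longleftrightarrow>
      q < length gs \<and> (\<forall>i<P. \<forall>j. P \<le> j \<and> j < q \<longrightarrow> xs ! i < xs ! j)"
    if "P < length gs" "P \<le> q" for P q
    using st that by (simp add: is_reach_list_def)
  have px: "p \<le> length xs" using p st1 by blast
  have pg: "p + gs ! p < length gs" using st2[of p "p + gs ! p"] p by simp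
  then have pgx: "p + gs ! p \<le> length xs" using st1 by blast
  note nth = nth_insert_at[OF px]
  have len: "q < length (advance gs p) \<longleftrightarrow> q \<le> length (insert_at p N xs) \<and> \<not> has231 (insert_at p N xs) q" for q
  proof (cases "q \<le> p")
    case True
    have "has231 (insert_at p N xs) q \<longleftrightarrow> has231 xs q"
      using True by (intro has231_cong) (simp add: nth)
    with True p px st1[of q] show ?thesis by auto
  next
    case False
    \<comment> \<open>A prefix longer than \<open>p\<close> contains the new maximum, hence the
      shift by one.\<close>
    then obtain q0 where q0: "q = Suc q0" "p \<le> q0" by (cases q) auto
    have "(\<exists>i<p. \<exists>j. p \<le> j \<and> j < q0 \<and> xs ! j < xs ! i) \<longleftrightarrow>
        \<not> (\<forall>i<p. \<forall>j. p \<le> j \<and> j < q0 \<longrightarrow> xs ! i < xs ! j)" if "q0 \<le> length xs"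
    proof -
      have "xs ! i \<noteq> xs ! j" if "i < p" "p \<le> j" "j < q0" for i j
        using that dist \<open>q0 \<le> length xs\<close> by (simp add: nth_eq_iff_index_eq)
      then show ?thesis by (metis linorder_neqE_nat less_not_sym)
    qed
    with has231_insert_at[OF less px q0(2)] st2[of p q0] p q0 st1[of q0] show ?thesis
      by (auto simp: q0)
  qed
  have "q \<le> P + advance gs p ! P \<longleftrightarrow> q < length (advance gs p) \<and>
      (\<forall>i<P. \<forall>j. P \<le> j \<and> j < q \<longrightarrow> insert_at p N xs ! i < insert_at p N xs ! j)"
    if P: "P < length (advance gs p)" and Pq: "P \<le> q" for P q
  proof (cases "p < P")
    case True
    then have eq: "advance gs p ! P = 0"
      using P by (auto simp: advance_def nth_append simp del: upt_Suc replicate_Suc)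
    show ?thesis
    proof (cases "q = P")
      case False
      then have "P < q" using Pq by simp
      have False if q: "q < length (advance gs p)"
        and lt: "\<forall>i<P. \<forall>j. P \<le> j \<and> j < q \<longrightarrow> insert_at p N xs ! i < insert_at p N xs ! j"
      proof -
        have "P - 1 < length xs" using q pgx \<open>P < q\<close> True by simp
        then show False using lt[rule_format, of p P] True \<open>P < q\<close> less[of "P - 1"]
          by (simp add: nth)
      qed
      with \<open>P < q\<close> show ?thesis by (auto simp: eq)
    qed (use P eq in auto)
  next
    case False
    then have PL: "P < length gs" "P \<le> p" using p by auto
    show ?thesis
    proof (cases "p \<le> P + gs ! P")
      case True
      then have eq: "advance gs p ! P = p + 1 + gs ! p - P"
        using PL by (auto simp: advance_def nth_append simp del: upt_Suc replicate_Suc)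
      have "insert_at p N xs ! i < insert_at p N xs ! j" if "i < P" "P \<le> j" "j < p + 1 + gs ! p" for i j
      proof -
        have i: "i < p" using that PL by simp
        consider "j < p" | "j = p" | "p < j" by linarith
        then show ?thesis
        proof cases
          case 1
          then show ?thesis using st2[of P p] PL p True that by (simp add: nth)
        next
          case 2
          then show ?thesis using i px less[of i] by (simp add: nth)
        next
          case 3
          have "\<forall>i<p. \<forall>j. p \<le> j \<and> j < p + gs ! p \<longrightarrow> xs ! i < xs ! j"
            using st2[of p "p + gs ! p"] p pg by simp
          moreover have "p \<le> j - 1" "j - 1 < p + gs ! p" using 3 that by simp_all
          ultimately have "xs ! i < xs ! (j - 1)" using i by blast
          with 3 i show ?thesis by (simp add: nth)
        qed
      qed
      with PL show ?thesis by (auto simp: eq)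
    next
      case False
      then have eq: "advance gs p ! P = gs ! P"
        using PL by (auto simp: advance_def nth_append simp del: upt_Suc replicate_Suc)
      have *: "(\<forall>i<P. \<forall>j. P \<le> j \<and> j < q' \<longrightarrow> insert_at p N xs ! i < insert_at p N xs ! j) \<longleftrightarrow>
          (\<forall>i<P. \<forall>j. P \<le> j \<and> j < q' \<longrightarrow> xs ! i < xs ! j)" if "q' \<le> p" for q'
        using that PL by (auto simp: nth)
      show ?thesis
      proof (cases "q \<le> p")
        case True
        then show ?thesis using st2[OF PL(1) Pq] * p by (auto simp: eq)
      next
        case q: False
        have "\<not> (\<forall>i<P. \<forall>j. P \<le> j \<and> j < p \<longrightarrow> insert_at p N xs ! i < insert_at p N xs ! j)"
          using st2[OF PL] False p *[of p] by simp
        then have "\<not> (\<forall>i<P. \<forall>j. P \<le> j \<and> j < q \<longrightarrow> insert_at p N xs ! i < insert_at p N xs ! j)"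
          using q by (meson less_le_trans nat_le_linear)
        with q False show ?thesis by (auto simp: eq)
      qed
    qed
  qed
  with len show ?thesis by (simp add: is_reach_list_def)
qed

text \<open>In this form a concrete pattern unfolds by \<open>All_less_Suc\<close> into finitely
  many inequalities.\<close>

lemma contains_pattern_iff:
  "contains_pattern \<tau> \<pi> \<longleftrightarrow>
     (\<exists>f. (\<forall>b<length \<tau>. \<forall>a<b. f a < f b) \<and> (\<forall>a<length \<tau>. f a < length \<pi>) \<and>
       (\<forall>a<length \<tau>. \<forall>b<length \<tau>. \<pi> ! f a < \<pi> ! f b \<longleftrightarrow> \<tau> ! a < \<tau> ! b))"
proof -
  have "strict_mono_on {..<n} f \<longleftrightarrow> (\<forall>b<n. \<forall>a<b. f a < f b)" for n and f :: "nat \<Rightarrow> nat"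
    unfolding strict_mono_on_def lessThan_iff by (meson less_trans)
  then show ?thesis
    by (simp only: contains_pattern_def image_subset_iff Ball_def lessThan_iff)
qed

lemma contains_231: "contains_pattern [2, 3, 1] xs \<longleftrightarrow> has231 xs (length xs)"
proof
  assume "contains_pattern [2, 3, 1] xs"
  then obtain f :: "nat \<Rightarrow> nat" where "f 0 < f 1" "f 1 < f 2" "f 2 < length xs"
      "xs ! f 2 < xs ! f 0" "xs ! f 0 < xs ! f 1"
    unfolding contains_pattern_iff by (auto simp: All_less_Suc numeral_nat)
  then show "has231 xs (length xs)" unfolding has231_def by blast
next
  assume "has231 xs (length xs)"
  then obtain i j l where "i < j" "j < l" "l < length xs" "xs ! l < xs ! i" "xs ! i < xs ! j"
    by (auto simp: has231_def)
  then show "contains_pattern [2, 3, 1] xs"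
    unfolding contains_pattern_iff
    by (intro exI[of _ "(!) [i, j, l]"]) (simp add: All_less_Suc)
qed

lemma contains_2314: "contains_pattern [2, 3, 1, 4] xs \<longleftrightarrow> has2314 xs (length xs)"
proof
  assume "contains_pattern [2, 3, 1, 4] xs"
  then obtain f :: "nat \<Rightarrow> nat" where "f 0 < f 1" "f 1 < f 2" "f 2 < f 3" "f 3 < length xs"
      "xs ! f 2 < xs ! f 0" "xs ! f 0 < xs ! f 1" "xs ! f 1 < xs ! f 3"
    unfolding contains_pattern_iff by (auto simp: All_less_Suc numeral_nat)
  then show "has2314 xs (length xs)" unfolding has2314_def by blast
next
  assume "has2314 xs (length xs)"
  then obtain i j l m where "i < j" "j < l" "l < m" "m < length xs"
      "xs ! l < xs ! i" "xs ! i < xs ! j" "xs ! j < xs ! m"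
    by (auto simp: has2314_def)
  then show "contains_pattern [2, 3, 1, 4] xs"
    unfolding contains_pattern_iff
    by (intro exI[of _ "(!) [i, j, l, m]"]) (simp add: All_less_Suc)
qed

section \<open>Generating 2314-avoiders by insertion\<close>

lemma perm_length: "xs \<in> permutations_of_set {1..n} \<Longrightarrow> length xs = n"
  using length_finite_permutations_of_set[of xs "{1..n}"] by simp

lemma av_perms_2314:
  "xs \<in> av_perms [2, 3, 1, 4] n \<longleftrightarrow> xs \<in> permutations_of_set {1..n} \<and> \<not> has2314 xs n"
  unfolding av_perms_def avoids_def contains_2314 using perm_length by blast

text \<open>The inverse map deletes \<open>Suc n\<close>; by \<open>has2314_insert_at\<close> the
  rest is an avoider and the place was a site.\<close>

lemma insert_at_bij:
  "bij_betw (\<lambda>(xs, p). insert_at p (Suc n) xs)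
     (SIGMA xs:av_perms [2, 3, 1, 4] n. {p. p \<le> n \<and> \<not> has231 xs p})
     (av_perms [2, 3, 1, 4] (Suc n))"
  (is "bij_betw ?f ?A ?B")
proof -
  have perm: "insert_at p (Suc n) xs \<in> permutations_of_set {1..Suc n} \<longleftrightarrow>
      xs \<in> permutations_of_set {1..n}" if "p \<le> length xs" "Suc n \<notin> set xs" for xs p
  proof -
    have "mset (insert_at p (Suc n) xs) = mset (Suc n # xs)"
      unfolding insert_at_def by (metis append_take_drop_id mset.simps(2) mset_append union_mset_add_mset_right)
    from mset_eq_setD[OF this] mset_eq_imp_distinct_iff[OF this]
    have "set (insert_at p (Suc n) xs) = insert (Suc n) (set xs)" "distinct (insert_at p (Suc n) xs) = distinct xs"
      using that by simp_all
    moreover have "{1..Suc n} = insert (Suc n) {1..n}" "Suc n \<notin> {1..n}"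
      by auto
    ultimately show ?thesis
      using that(2) insert_ident[of "Suc n" "set xs" "{1..n}"]
      unfolding permutations_of_set_def by auto
  qed
  have nin: "Suc n \<notin> set xs" if "xs \<in> permutations_of_set {1..n}" for xs
    using that by (auto simp: permutations_of_set_def)
  have av: "insert_at p (Suc n) xs \<in> ?B \<longleftrightarrow> xs \<in> av_perms [2, 3, 1, 4] n \<and> \<not> has231 xs p"
    if "xs \<in> permutations_of_set {1..n}" "p \<le> n" for xs p
  proof -
    have "xs ! i < Suc n" if "i < length xs" for i
      using that \<open>xs \<in> _\<close> nth_mem[of i xs] by (auto simp: permutations_of_set_def)
    then show ?thesis
      using that has2314_insert_at[of xs "Suc n" p] perm[of p xs] perm_length[of xs] nin[of xs]
      unfolding av_perms_2314 by simp
  qed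
  show ?thesis
    unfolding bij_betw_def
  proof
    show "inj_on ?f ?A"
    proof (rule inj_onI, clarify)
      fix xs p ys q
      assume *: "xs \<in> av_perms [2, 3, 1, 4] n" "ys \<in> av_perms [2, 3, 1, 4] n" "p \<le> n" "q \<le> n"
        and eq: "insert_at p (Suc n) xs = insert_at q (Suc n) ys"
      from * have nin: "Suc n \<notin> set (take p xs)" "Suc n \<notin> set (drop p xs)"
        "length xs = n" "length ys = n"
        using nin by (auto simp: av_perms_def perm_length dest: in_set_takeD in_set_dropD)
      from eq have "take p xs = take q ys \<and> drop p xs = drop q ys"
        using append_Cons_eq_iff[OF nin(1,2)] by (simp add: insert_at_def)
      then show "xs = ys \<and> p = q"
        using nin * by (metis append_take_drop_id length_take min.absorb2)
    qed
    show "?f ` ?A = ?B"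
    proof (intro equalityI subsetI)
      fix xs assume "xs \<in> ?f ` ?A"
      then show "xs \<in> ?B" using av by (auto simp: av_perms_def)
    next
      fix zs assume zs: "zs \<in> ?B"
      then have "Suc n \<in> set zs"
        by (auto simp: av_perms_def permutations_of_set_def)
      then obtain as bs where ab: "zs = as @ Suc n # bs" by (meson split_list)
      have "distinct zs" using zs by (simp add: av_perms_def permutations_of_set_def)
      then have nin: "Suc n \<notin> set (as @ bs)" by (simp add: ab)
      have eq: "zs = insert_at (length as) (Suc n) (as @ bs)" by (simp add: ab insert_at_def)
      have p: "as @ bs \<in> permutations_of_set {1..n}"
        using perm[of "length as" "as @ bs"] nin zs by (simp add: eq av_perms_def)
      then have "length as \<le> n" using perm_length by fastforce
      with av[OF p] zs show "zs \<in> ?f ` ?A"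
        unfolding eq by (force intro: image_eqI[of _ _ "(as @ bs, length as)"])
    qed
  qed
qed

definition reach_list :: "nat list \<Rightarrow> nat list" where
  "reach_list xs = (THE gs. is_reach_list xs gs)"

lemma reach_list_eqI: "is_reach_list xs gs \<Longrightarrow> reach_list xs = gs"
  unfolding reach_list_def using is_reach_list_unique by blast

lemma av_perms_D:
  assumes "xs \<in> av_perms \<sigma> n"
  shows "distinct xs" "length xs = n" "i < length xs \<Longrightarrow> xs ! i < Suc n"
  using assms perm_length[of xs n] nth_mem[of i xs]
  by (auto simp: av_perms_def permutations_of_set_def)

lemma finite_av_perms [simp]: "finite (av_perms \<sigma> n)"
  by (simp add: av_perms_def)

lemma av_perms_0: "\<sigma> \<noteq> [] \<Longrightarrow> av_perms \<sigma> 0 = {[]}"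
  by (cases \<sigma>) (auto simp: av_perms_def avoids_def contains_pattern_def)

lemma is_reach_list_reach_list: "xs \<in> av_perms [2, 3, 1, 4] n \<Longrightarrow> is_reach_list xs (reach_list xs)"
proof -
  have "\<exists>gs. is_reach_list xs gs" if "xs \<in> av_perms [2, 3, 1, 4] n"
    using that
  proof (induction n arbitrary: xs)
    case 0
    then show ?case using is_reach_list_Nil by (auto simp: av_perms_0)
  next
    case (Suc n)
    from \<open>xs \<in> _\<close> have "xs \<in> (\<lambda>(xs, p). insert_at p (Suc n) xs) `
        (SIGMA xs:av_perms [2, 3, 1, 4] n. {p. p \<le> n \<and> \<not> has231 xs p})"
      by (simp only: bij_betw_imp_surj_on[OF insert_at_bij])
    then obtain ys p where ys: "ys \<in> av_perms [2, 3, 1, 4] n" "p \<le> n" "\<not> has231 ys p"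
      "xs = insert_at p (Suc n) ys"
      by (auto simp del: One_nat_def)
    from Suc.IH[OF ys(1)] obtain gs where gs: "is_reach_list ys gs" ..
    with ys have "p < length gs" using av_perms_D[OF ys(1)] by (simp add: is_reach_list_def)
    with gs ys show ?case using is_reach_list_insert_at[of ys "Suc n" gs p] av_perms_D[OF ys(1)] by auto
  qed
  then show "xs \<in> av_perms [2, 3, 1, 4] n \<Longrightarrow> is_reach_list xs (reach_list xs)"
    using reach_list_eqI by metis
qed

text \<open>Coefficient \<open>m\<close> of \<open>size_gf 1 gs\<close> counts the insertion
  sequences of length \<open>m\<close> from \<open>gs\<close>. The induction moves one insertion at
  a time from the sequence into the permutation, from \<open>av_series\<close> at
  \<open>n = 0\<close> to the number of avoiders at \<open>m = 0\<close>.\<close>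

lemma av_series_nth_add:
  "fps_nth av_series (n + m) = (\<Sum>xs\<in>av_perms [2, 3, 1, 4] n. fps_nth (size_gf 1 (reach_list xs)) m)"
proof (induction n arbitrary: m)
  case 0
  then show ?case by (simp add: av_perms_0 reach_list_eqI[OF is_reach_list_Nil] av_series_def)
next
  case (Suc n)
  let ?A = "av_perms [2, 3, 1, 4]"
  have eq: "{p. p \<le> n \<and> \<not> has231 xs p} = {..<length (reach_list xs)}" if "xs \<in> ?A n" for xs
    using is_reach_list_reach_list[OF that] av_perms_D[OF that] by (auto simp: is_reach_list_def)
  have st: "reach_list (insert_at p (Suc n) xs) = advance (reach_list xs) p"
    if "xs \<in> ?A n" "p < length (reach_list xs)" for xs p
    using is_reach_list_insert_at[OF _ _ is_reach_list_reach_list[OF that(1)]] that av_perms_D[OF that(1)]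
    by (intro reach_list_eqI) auto
  have "(\<Sum>xs\<in>?A (Suc n). fps_nth (size_gf 1 (reach_list xs)) m) =
      (\<Sum>(xs, p)\<in>(SIGMA xs:?A n. {p. p \<le> n \<and> \<not> has231 xs p}).
        fps_nth (size_gf 1 (reach_list (insert_at p (Suc n) xs))) m)"
    by (subst sum.reindex_bij_betw[OF insert_at_bij, symmetric]) (simp add: case_prod_unfold)
  also have "\<dots> = (\<Sum>xs\<in>?A n. \<Sum>p | p \<le> n \<and> \<not> has231 xs p.
        fps_nth (size_gf 1 (reach_list (insert_at p (Suc n) xs))) m)"
    by (rule sum.Sigma[symmetric]) auto
  also have "\<dots> = (\<Sum>xs\<in>?A n. \<Sum>p<length (reach_list xs). fps_nth (size_gf 1 (advance (reach_list xs) p)) m)"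
    by (intro sum.cong) (simp_all add: eq st)
  also have "\<dots> = (\<Sum>xs\<in>?A n. fps_nth (size_gf 1 (reach_list xs)) (Suc m))"
    by (subst (2) size_gf_rec) (simp add: fps_sum_nth)
  also have "\<dots> = fps_nth av_series (n + Suc m)"
    by (rule Suc.IH[symmetric])
  finally show ?case by simp
qed

lemma av_series_nth: "fps_nth av_series n = real (card (av_perms [2, 3, 1, 4] n))"
proof -
  have "fps_nth (size_gf 1 gs) 0 = 1" for gs
    by (subst size_gf_rec) simp
  with av_series_nth_add[of n 0] show ?thesis by simp
qed

section \<open>Inverse and reverse complement\<close>

lemma perm_nth:
  assumes "xs \<in> permutations_of_set {1..n}" "i < n"
  shows "1 \<le> xs ! i" "xs ! i \<le> n"
  using assms nth_mem[of i xs] perm_length[OF assms(1)] by (auto simp: permutations_of_set_def)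

lemma permI:
  assumes "length xs = n" "distinct xs" "set xs \<subseteq> {1..n}"
  shows "xs \<in> permutations_of_set {1..n}"
  using assms card_subset_eq[of "{1..n}" "set xs"] distinct_card[of xs]
  by (auto simp: permutations_of_set_def)

text \<open>The inverse permutation; \<open>takeWhile\<close> finds the 0-based position of a value.\<close>

definition pinv :: "nat list \<Rightarrow> nat list" where
  "pinv \<pi> = map (\<lambda>v. Suc (length (takeWhile (\<lambda>w. w \<noteq> v) \<pi>))) [1..<Suc (length \<pi>)]"

lemma length_pinv [simp]: "length (pinv \<pi>) = length \<pi>"
  by (simp add: pinv_def del: upt_Suc)

lemma pinv_nth:
  assumes "\<pi> \<in> permutations_of_set {1..n}" "i < n"
  shows "pinv \<pi> ! (\<pi> ! i - 1) = Suc i"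
proof -
  have len: "length \<pi> = n" and "distinct \<pi>"
    using assms perm_length by (auto simp: permutations_of_set_def)
  then have "takeWhile (\<lambda>w. w \<noteq> \<pi> ! i) \<pi> = take i \<pi>"
    using assms(2) by (intro takeWhile_eq_take_P_nth) (auto simp: nth_eq_iff_index_eq)
  moreover have "[1..<Suc n] ! (\<pi> ! i - 1) = \<pi> ! i" "\<pi> ! i - 1 < n"
    using perm_nth[OF assms] by (subst nth_upt, auto)
  ultimately show ?thesis
    using assms(2) len by (simp add: pinv_def del: upt_Suc One_nat_def)
qed

lemma perm_ex_nth:
  assumes "\<pi> \<in> permutations_of_set {1..n}" "k < n"
  shows "\<exists>i<n. \<pi> ! i = Suc k"
proof -
  have "Suc k \<in> set \<pi>" using assms by (auto simp: permutations_of_set_def)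
  then show ?thesis using perm_length[OF assms(1)] by (auto simp: in_set_conv_nth)
qed

lemma pinv_perm:
  assumes "\<pi> \<in> permutations_of_set {1..n}"
  shows "pinv \<pi> \<in> permutations_of_set {1..n}"
proof (rule permI)
  show len: "length (pinv \<pi>) = n" using assms perm_length by simp
  have nth: "\<exists>i<n. \<pi> ! i = Suc k \<and> pinv \<pi> ! k = Suc i" if "k < n" for k
    using perm_ex_nth[OF assms that] pinv_nth[OF assms] by force
  show "distinct (pinv \<pi>)"
    unfolding distinct_conv_nth len
  proof (intro allI impI notI)
    fix a b assume ab: "a < n" "b < n" "a \<noteq> b" "pinv \<pi> ! a = pinv \<pi> ! b"
    from nth[OF ab(1)] nth[OF ab(2)] ab(3,4) show False by auto
  qed
  show "set (pinv \<pi>) \<subseteq> {1..n}"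
  proof
    fix x assume "x \<in> set (pinv \<pi>)"
    then obtain k where "k < n" "x = pinv \<pi> ! k" by (metis in_set_conv_nth len)
    with nth[of k] show "x \<in> {1..n}" by auto
  qed
qed

lemma pinv_pinv:
  assumes "\<pi> \<in> permutations_of_set {1..n}"
  shows "pinv (pinv \<pi>) = \<pi>"
proof (rule nth_equalityI)
  fix i assume "i < length (pinv (pinv \<pi>))"
  then have i: "i < n" using perm_length[OF assms] by simp
  note v = perm_nth[OF assms i]
  have "pinv \<pi> ! (\<pi> ! i - 1) - 1 = i"
    by (simp only: pinv_nth[OF assms i] diff_Suc_1)
  moreover have "pinv (pinv \<pi>) ! (pinv \<pi> ! (\<pi> ! i - 1) - 1) = Suc (\<pi> ! i - 1)"
    using v by (intro pinv_nth[OF pinv_perm[OF assms]]) simp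
  ultimately show "pinv (pinv \<pi>) ! i = \<pi> ! i"
    using v by simp
qed simp

lemma nth_pinv:
  assumes "\<pi> \<in> permutations_of_set {1..n}" "k < n"
  shows "\<pi> ! (pinv \<pi> ! k - 1) = Suc k"
  using pinv_nth[OF pinv_perm[OF assms(1)] assms(2)] pinv_pinv[OF assms(1)] by simp

text \<open>An occurrence is a set of points (position, value), and inversion swaps the
  coordinates.\<close>

lemma contains_pinv:
  assumes \<tau>: "\<tau> \<in> permutations_of_set {1..k}" and \<pi>: "\<pi> \<in> permutations_of_set {1..n}"
    and c: "contains_pattern \<tau> \<pi>"
  shows "contains_pattern (pinv \<tau>) (pinv \<pi>)"
proof -
  note len = perm_length[OF \<tau>] perm_length[OF \<pi>]
  from c obtain f where "\<forall>b<k. \<forall>a<b. f a < f b" "\<forall>a<k. f a < n"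
    "\<forall>a<k. \<forall>b<k. \<pi> ! f a < \<pi> ! f b \<longleftrightarrow> \<tau> ! a < \<tau> ! b"
    unfolding contains_pattern_iff len by (elim exE conjE)
  then have f: "\<And>a b. b < k \<Longrightarrow> a < b \<Longrightarrow> f a < f b" "\<And>a. a < k \<Longrightarrow> f a < n"
    "\<And>a b. a < k \<Longrightarrow> b < k \<Longrightarrow> \<pi> ! f a < \<pi> ! f b \<longleftrightarrow> \<tau> ! a < \<tau> ! b"
    by simp_all
  define u where "u a = pinv \<tau> ! a - 1" for a
  have u: "u a < k" "\<tau> ! u a = Suc a" "pinv \<tau> ! a = Suc (u a)" if "a < k" for a
    using perm_nth[OF pinv_perm[OF \<tau>] that] nth_pinv[OF \<tau> that] by (auto simp: u_def)
  have f_less: "f a < f b \<longleftrightarrow> a < b" if "a < k" "b < k" for a b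
    using that f(1)[of b a] f(1)[of a b] by (cases a b rule: linorder_cases) auto
  \<comment> \<open>\<open>u a\<close> is the position of the value \<open>a + 1\<close> in \<tau>,
    so \<open>g a\<close> is the value (counted from 0) of the entry of \<pi> that plays it. These
    values increase with \<open>a\<close> and are the positions in the inverse.\<close>
  define g where "g a = \<pi> ! f (u a) - 1" for a
  have pos: "1 \<le> \<pi> ! f (u a)" "\<pi> ! f (u a) \<le> n" if "a < k" for a
    using perm_nth[OF \<pi> f(2)[OF u(1)[OF that]]] by auto
  have "g a < g b" if "b < k" "a < b" for a b
  proof -
    have "a < k" using that by simp
    with that have "\<pi> ! f (u a) < \<pi> ! f (u b)" by (simp add: f(3) u)
    then show ?thesis using pos(1)[OF \<open>a < k\<close>] by (simp add: g_def)
  qed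
  moreover have "g a < n" if "a < k" for a
    using pos[OF that] by (simp add: g_def)
  moreover have "pinv \<pi> ! g a < pinv \<pi> ! g b \<longleftrightarrow> pinv \<tau> ! a < pinv \<tau> ! b"
    if "a < k" "b < k" for a b
  proof -
    have "pinv \<pi> ! g a = Suc (f (u a))" if "a < k" for a
      unfolding g_def by (intro pinv_nth[OF \<pi>] f(2) u(1) that)
    with that show ?thesis by (simp add: f_less u)
  qed
  ultimately show ?thesis
    unfolding contains_pattern_iff length_pinv len by (intro exI[of _ g] conjI allI impI)
qed

section \<open>The reverse complement\<close>

definition rev_compl :: "nat list \<Rightarrow> nat list" where
  "rev_compl \<pi> = rev (map (\<lambda>v. Suc (length \<pi>) - v) \<pi>)"

lemma length_rev_compl [simp]: "length (rev_compl \<pi>) = length \<pi>"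
  by (simp add: rev_compl_def)

lemma rev_compl_nth:
  "i < length \<pi> \<Longrightarrow> rev_compl \<pi> ! i = Suc (length \<pi>) - \<pi> ! (length \<pi> - 1 - i)"
  by (simp add: rev_compl_def rev_nth)

lemma rev_compl_eq:
  assumes "\<pi> \<in> permutations_of_set {1..n}"
  shows "rev_compl \<pi> = rev (map ((-) (Suc n)) \<pi>)"
  by (simp only: rev_compl_def perm_length[OF assms])

lemma rev_compl_perm:
  assumes "\<pi> \<in> permutations_of_set {1..n}"
  shows "rev_compl \<pi> \<in> permutations_of_set {1..n}"
proof (rule permI)
  note \<pi> = permutations_of_setD[OF assms]
  have "inj_on ((-) (Suc n)) {1..n}"
  proof (rule inj_onI)
    fix x y assume "x \<in> {1..n}" "y \<in> {1..n}" "Suc n - x = Suc n - y"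
    then show "x = y" unfolding atLeastAtMost_iff by linarith
  qed
  with \<pi> show "distinct (rev_compl \<pi>)"
    by (simp only: rev_compl_eq[OF assms] distinct_rev distinct_map simp_thms)
  show "set (rev_compl \<pi>) \<subseteq> {1..n}"
    by (simp only: rev_compl_eq[OF assms] set_rev set_map \<pi>) auto
qed (simp add: perm_length[OF assms])

lemma rev_compl_rev_compl:
  assumes "\<pi> \<in> permutations_of_set {1..n}"
  shows "rev_compl (rev_compl \<pi>) = \<pi>"
proof -
  have "rev_compl (rev_compl \<pi>) = map (\<lambda>v. Suc n - (Suc n - v)) \<pi>"
    by (subst rev_compl_eq[OF rev_compl_perm[OF assms]], subst rev_compl_eq[OF assms])
       (simp only: rev_map rev_rev_ident map_map comp_def)
  also have "\<dots> = \<pi>"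
    using permutations_of_setD(1)[OF assms] by (intro map_idI) simp
  finally show ?thesis .
qed

lemma contains_rev_compl:
  assumes \<tau>: "\<tau> \<in> permutations_of_set {1..k}" and \<pi>: "\<pi> \<in> permutations_of_set {1..n}"
    and c: "contains_pattern \<tau> \<pi>"
  shows "contains_pattern (rev_compl \<tau>) (rev_compl \<pi>)"
proof -
  note len = perm_length[OF \<tau>] perm_length[OF \<pi>]
  from c obtain f where "\<forall>b<k. \<forall>a<b. f a < f b" "\<forall>a<k. f a < n"
    "\<forall>a<k. \<forall>b<k. \<pi> ! f a < \<pi> ! f b \<longleftrightarrow> \<tau> ! a < \<tau> ! b"
    unfolding contains_pattern_iff len by (elim exE conjE)
  then have f: "\<And>a b. b < k \<Longrightarrow> a < b \<Longrightarrow> f a < f b" "\<And>a. a < k \<Longrightarrow> f a < n"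
    "\<And>a b. a < k \<Longrightarrow> b < k \<Longrightarrow> \<pi> ! f a < \<pi> ! f b \<longleftrightarrow> \<tau> ! a < \<tau> ! b"
    by simp_all
  define g where "g a = n - 1 - f (k - 1 - a)" for a
  have "g a < g b" if "b < k" "a < b" for a b
  proof -
    have "f (k - 1 - b) < f (k - 1 - a)" "f (k - 1 - a) < n"
      using that by (auto intro!: f(1,2))
    then show ?thesis unfolding g_def by linarith
  qed
  moreover have "g a < n" if "a < k" for a
    using f(2)[of "k - 1 - a"] that unfolding g_def by linarith
  moreover have "rev_compl \<pi> ! g a < rev_compl \<pi> ! g b \<longleftrightarrow> rev_compl \<tau> ! a < rev_compl \<tau> ! b"
    if ab: "a < k" "b < k" for a b
  proof -
    have *: "rev_compl \<pi> ! g a = Suc n - \<pi> ! f (k - 1 - a)" "\<pi> ! f (k - 1 - a) \<le> n"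
      "rev_compl \<tau> ! a = Suc k - \<tau> ! (k - 1 - a)" "\<tau> ! (k - 1 - a) \<le> k" if "a < k" for a
    proof -
      have a: "k - 1 - a < k" using that by simp
      note fa = f(2)[OF a]
      have "g a < n" "n - 1 - g a = f (k - 1 - a)" using fa unfolding g_def by linarith+
      then show "rev_compl \<pi> ! g a = Suc n - \<pi> ! f (k - 1 - a)"
        using rev_compl_nth[of "g a" \<pi>] len by simp
      show "\<pi> ! f (k - 1 - a) \<le> n" by (rule perm_nth(2)[OF \<pi> fa])
      show "rev_compl \<tau> ! a = Suc k - \<tau> ! (k - 1 - a)"
        using rev_compl_nth[of a \<tau>] len that by simp
      show "\<tau> ! (k - 1 - a) \<le> k" by (rule perm_nth(2)[OF \<tau> a])
    qed
    \<comment> \<open>Complementing reverses the order only below the bound, because the subtraction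
      is truncated.\<close>
    have less: "Suc m - x < Suc m - y \<longleftrightarrow> y < x" if "x \<le> m" "y \<le> m" for m x y :: nat
      using that by linarith
    have "k - 1 - b < k" "k - 1 - a < k" using ab by auto
    from f(3)[OF this] show ?thesis
      by (simp only: *[OF ab(1)] *[OF ab(2)] less)
  qed
  ultimately show ?thesis
    unfolding contains_pattern_iff length_rev_compl len by (intro exI[of _ g] conjI allI impI)
qed

text \<open>One-sided implications suffice because \<open>g\<close> is an involution: applying them
  to \<open>g \<pi>\<close> gives the converses.\<close>

lemma card_av_perms_eq:
  assumes perm: "\<And>\<pi>. \<pi> \<in> permutations_of_set {1..n} \<Longrightarrow> g \<pi> \<in> permutations_of_set {1..n}"
    and inv: "\<And>\<pi>. \<pi> \<in> permutations_of_set {1..n} \<Longrightarrow> g (g \<pi>) = \<pi>"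
    and "\<And>\<pi>. \<pi> \<in> permutations_of_set {1..n} \<Longrightarrow> contains_pattern \<sigma> \<pi> \<Longrightarrow> contains_pattern \<tau> (g \<pi>)"
    and "\<And>\<pi>. \<pi> \<in> permutations_of_set {1..n} \<Longrightarrow> contains_pattern \<tau> \<pi> \<Longrightarrow> contains_pattern \<sigma> (g \<pi>)"
  shows "card (av_perms \<sigma> n) = card (av_perms \<tau> n)"
proof (rule bij_betw_same_card)
  have iff: "contains_pattern \<tau> (g \<pi>) \<longleftrightarrow> contains_pattern \<sigma> \<pi>"
    "contains_pattern \<sigma> (g \<pi>) \<longleftrightarrow> contains_pattern \<tau> \<pi>"
    if "\<pi> \<in> permutations_of_set {1..n}" for \<pi>
    using assms(3,4)[OF that] assms(3,4)[OF perm[OF that]] inv[OF that] by auto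
  show "bij_betw g (av_perms \<sigma> n) (av_perms \<tau> n)"
  proof (rule bij_betw_byWitness[where f' = g])
    show "g ` av_perms \<sigma> n \<subseteq> av_perms \<tau> n"
    proof (rule image_subsetI)
      fix \<pi> assume "\<pi> \<in> av_perms \<sigma> n"
      then have "\<pi> \<in> permutations_of_set {1..n}" "\<not> contains_pattern \<sigma> \<pi>"
        by (simp_all add: av_perms_def avoids_def)
      with perm[of \<pi>] iff(1)[of \<pi>] show "g \<pi> \<in> av_perms \<tau> n"
        by (simp add: av_perms_def avoids_def)
    qed
    show "g ` av_perms \<tau> n \<subseteq> av_perms \<sigma> n"
    proof (rule image_subsetI)
      fix \<pi> assume "\<pi> \<in> av_perms \<tau> n"
      then have "\<pi> \<in> permutations_of_set {1..n}" "\<not> contains_pattern \<tau> \<pi>"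
        by (simp_all add: av_perms_def avoids_def)
      with perm[of \<pi>] iff(2)[of \<pi>] show "g \<pi> \<in> av_perms \<sigma> n"
        by (simp add: av_perms_def avoids_def)
    qed
  qed (simp_all add: av_perms_def inv)
qed

lemma card_av_perms_pinv:
  assumes "\<tau> \<in> permutations_of_set {1..k}"
  shows "card (av_perms (pinv \<tau>) n) = card (av_perms \<tau> n)"
proof (rule card_av_perms_eq[of n pinv])
  fix \<pi> assume \<pi>: "\<pi> \<in> permutations_of_set {1..n}"
  show "pinv \<pi> \<in> permutations_of_set {1..n}" "pinv (pinv \<pi>) = \<pi>"
    using \<pi> by (rule pinv_perm, rule pinv_pinv)
  show "contains_pattern \<tau> (pinv \<pi>)" if "contains_pattern (pinv \<tau>) \<pi>"
    using contains_pinv[OF pinv_perm[OF assms] \<pi> that] by (simp only: pinv_pinv[OF assms])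
  show "contains_pattern (pinv \<tau>) (pinv \<pi>)" if "contains_pattern \<tau> \<pi>"
    using assms \<pi> that by (rule contains_pinv)
qed

lemma card_av_perms_rev_compl:
  assumes "\<tau> \<in> permutations_of_set {1..k}"
  shows "card (av_perms (rev_compl \<tau>) n) = card (av_perms \<tau> n)"
proof (rule card_av_perms_eq[of n rev_compl])
  fix \<pi> assume \<pi>: "\<pi> \<in> permutations_of_set {1..n}"
  show "rev_compl \<pi> \<in> permutations_of_set {1..n}" "rev_compl (rev_compl \<pi>) = \<pi>"
    using \<pi> by (rule rev_compl_perm, rule rev_compl_rev_compl)
  show "contains_pattern \<tau> (rev_compl \<pi>)" if "contains_pattern (rev_compl \<tau>) \<pi>"
    using contains_rev_compl[OF rev_compl_perm[OF assms] \<pi> that] by (simp only: rev_compl_rev_compl[OF assms])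
  show "contains_pattern (rev_compl \<tau>) (rev_compl \<pi>)" if "contains_pattern \<tau> \<pi>"
    using assms \<pi> that by (rule contains_rev_compl)
qed

lemma
  card_av_perms_312: "card (av_perms [3, 1, 2] n) = card (av_perms [2, 3, 1] n)" and
  card_av_perms_3124: "card (av_perms [3, 1, 2, 4] n) = card (av_perms [2, 3, 1, 4] n)" and
  card_av_perms_1342: "card (av_perms [1, 3, 4, 2] n) = card (av_perms [3, 1, 2, 4] n)"
proof -
  have p: "[2, 3, 1 :: nat] \<in> permutations_of_set {1..3}" "[2, 3, 1, 4 :: nat] \<in> permutations_of_set {1..4}"
    "[3, 1, 2, 4 :: nat] \<in> permutations_of_set {1..4}"
    by (auto simp: permutations_of_set_def)
  have e: "pinv [2, 3, 1] = [3, 1, 2]" "pinv [2, 3, 1, 4] = [3, 1, 2, 4]"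
    "rev_compl [3, 1, 2, 4] = [1, 3, 4, 2]"
    by (simp_all add: pinv_def rev_compl_def)
  show "card (av_perms [3, 1, 2] n) = card (av_perms [2, 3, 1] n)"
    using card_av_perms_pinv[OF p(1), of n] unfolding e .
  show "card (av_perms [3, 1, 2, 4] n) = card (av_perms [2, 3, 1, 4] n)"
    using card_av_perms_pinv[OF p(2), of n] unfolding e .
  show "card (av_perms [1, 3, 4, 2] n) = card (av_perms [3, 1, 2, 4] n)"
    using card_av_perms_rev_compl[OF p(3), of n] unfolding e .
qed

section \<open>Direct sums\<close>

definition dsum :: "nat list \<Rightarrow> nat list \<Rightarrow> nat list" where
  "dsum \<alpha> \<beta> = \<alpha> @ map ((+) (length \<alpha>)) \<beta>"

lemma length_dsum [simp]: "length (dsum \<alpha> \<beta>) = length \<alpha> + length \<beta>"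
  by (simp add: dsum_def)

lemma dsum_nth:
  "dsum \<alpha> \<beta> ! i = (if i < length \<alpha> then \<alpha> ! i else length \<alpha> + \<beta> ! (i - length \<alpha>))"
  if "i < length \<alpha> + length \<beta>"
  using that by (auto simp: dsum_def nth_append)

lemma dsum_perm:
  assumes "\<alpha> \<in> permutations_of_set {1..k}" "\<beta> \<in> permutations_of_set {1..m}"
  shows "dsum \<alpha> \<beta> \<in> permutations_of_set {1..k + m}"
proof -
  note p = permutations_of_setD[OF assms(1)] permutations_of_setD[OF assms(2)]
    perm_length[OF assms(1)]
  have "(+) k ` {1..m} = {k + 1..k + m}"
    by (simp add: image_add_atLeastAtMost add.commute)
  with p show ?thesis
    by (auto simp: permutations_of_set_def dsum_def distinct_map simp del: One_nat_def)
qed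

text \<open>The junction is never a descent, as all of \<alpha> lies below the shifted
  \<beta>.\<close>

lemma descents_dsum:
  assumes "\<alpha> \<in> permutations_of_set {1..k}" "\<beta> \<in> permutations_of_set {1..m}"
  shows "card (descents (dsum \<alpha> \<beta>)) = card (descents \<alpha>) + card (descents \<beta>)"
proof -
  note len = perm_length[OF assms(1)] perm_length[OF assms(2)]
  have "i \<in> descents (dsum \<alpha> \<beta>) \<longleftrightarrow> i \<in> descents \<alpha> \<union> (+) k ` descents \<beta>" for i
  proof -
    consider "Suc i < k" | "Suc i = k" | j where "i = k + j"
      by (metis le_Suc_ex linorder_cases not_less_eq_eq Suc_leI)
    then show ?thesis
    proof cases
      case 1
      then show ?thesis by (auto simp: descents_def dsum_nth len)
    next
      case 2
      then have "\<alpha> ! i \<le> k" using perm_nth[OF assms(1), of i] by simp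
      with 2 show ?thesis by (auto simp: descents_def dsum_nth len)
    next
      case 3
      then show ?thesis by (auto simp: descents_def dsum_nth len image_iff)
    qed
  qed
  then have eq: "descents (dsum \<alpha> \<beta>) = descents \<alpha> \<union> (+) k ` descents \<beta>" by blast
  have "descents \<alpha> \<subseteq> {..<k}" "descents \<beta> \<subseteq> {..<m}"
    by (auto simp: descents_def len)
  moreover from this have "finite (descents \<alpha>)" "finite (descents \<beta>)"
    by (auto intro: finite_subset)
  ultimately show ?thesis
    unfolding eq by (subst card_Un_disjoint) (auto simp: card_image)
qed

section \<open>Splitting off the first indecomposable summand\<close>

lemma first_index:
  assumes "\<pi> \<in> permutations_of_set {1..n}" "n > 0"
  shows "1 \<le> first_index \<pi>" "first_index \<pi> \<le> n"
    "set (take (first_index \<pi>) \<pi>) = {1..first_index \<pi>}"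
proof -
  have *: "1 \<le> n \<and> set (take n \<pi>) = {1..n}"
    using assms perm_length[OF assms(1)] by (simp add: permutations_of_set_def)
  from LeastI[of "\<lambda>i. 1 \<le> i \<and> set (take i \<pi>) = {1..i}", OF *]
    Least_le[of "\<lambda>i. 1 \<le> i \<and> set (take i \<pi>) = {1..i}", OF *]
  show "1 \<le> first_index \<pi>" "first_index \<pi> \<le> n"
    "set (take (first_index \<pi>) \<pi>) = {1..first_index \<pi>}"
    unfolding first_index_def by auto
qed

text \<open>Prefixes of length at most \<open>k\<close> lie within \<alpha>. The cut can thus be
  read off the sum, which makes the decomposition unique.\<close>

lemma first_index_dsum:
  assumes "\<alpha> \<in> permutations_of_set {1..k}" "indecomposable \<alpha>"
  shows "first_index (dsum \<alpha> \<beta>) = k"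
proof -
  have len: "length \<alpha> = k" by (rule perm_length[OF assms(1)])
  have k: "first_index \<alpha> = k" "k > 0" using assms(2) len by (auto simp: indecomposable_def)
  have t: "take i (dsum \<alpha> \<beta>) = take i \<alpha>" if "i \<le> k" for i
    using that len by (simp add: dsum_def)
  show ?thesis
    unfolding first_index_def
  proof (rule Least_equality)
    show "1 \<le> k \<and> set (take k (dsum \<alpha> \<beta>)) = {1..k}"
      using k t[of k] assms(1) len by (simp add: permutations_of_set_def)
  next
    fix i assume i: "1 \<le> i \<and> set (take i (dsum \<alpha> \<beta>)) = {1..i}"
    show "k \<le> i"
    proof (rule ccontr)
      assume "\<not> k \<le> i"
      then have "1 \<le> i \<and> set (take i \<alpha>) = {1..i}" using i t[of i] by simp
      then have "first_index \<alpha> \<le> i" unfolding first_index_def by (rule Least_le)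
      with k \<open>\<not> k \<le> i\<close> show False by simp
    qed
  qed
qed

lemma dsum_decompose:
  assumes \<pi>: "\<pi> \<in> permutations_of_set {1..n}" and n: "n > 0"
  defines "k \<equiv> first_index \<pi>"
  obtains \<alpha> \<beta> where "\<alpha> \<in> permutations_of_set {1..k}" "\<beta> \<in> permutations_of_set {1..n - k}"
    "indecomposable \<alpha>" "\<pi> = dsum \<alpha> \<beta>"
proof -
  note k = first_index[OF \<pi> n, folded k_def]
  note len = perm_length[OF \<pi>]
  have set: "set \<pi> = {1..n}" and dist: "distinct \<pi>"
    using \<pi> by (auto simp: permutations_of_set_def)
  define \<alpha> where "\<alpha> = take k \<pi>"
  define \<beta> where "\<beta> = map (\<lambda>x. x - k) (drop k \<pi>)"
  have \<alpha>: "\<alpha> \<in> permutations_of_set {1..k}" "length \<alpha> = k"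
    using k dist len by (auto simp: \<alpha>_def permutations_of_set_def)
  have "set (drop k \<pi>) = set \<pi> - set (take k \<pi>)"
    using dist set_take_disj_set_drop_if_distinct[OF dist order_refl, of k]
    by (metis Diff_cancel Diff_triv Un_Diff append_take_drop_id inf_commute set_append sup_bot_left)
  then have drop: "set (drop k \<pi>) = {k + 1..n}"
    using k set by auto
  have "inj_on (\<lambda>x. x - k) {k + 1..n}"
    by (rule inj_onI) auto
  moreover have "(\<lambda>x. x - k) ` {k + 1..n} = {1..n - k}"
  proof (intro equalityI subsetI)
    fix x assume "x \<in> {1..n - k}"
    then show "x \<in> (\<lambda>x. x - k) ` {k + 1..n}" by (intro image_eqI[of _ _ "x + k"]) auto
  qed auto
  ultimately have \<beta>: "\<beta> \<in> permutations_of_set {1..n - k}"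
    using dist drop by (simp add: \<beta>_def permutations_of_set_def distinct_map del: One_nat_def)
  have "map ((+) k) \<beta> = map (\<lambda>x. k + (x - k)) (drop k \<pi>)"
    by (simp add: \<beta>_def)
  also have "\<dots> = drop k \<pi>"
    by (rule map_idI) (simp add: drop)
  finally have eq: "\<pi> = dsum \<alpha> \<beta>"
    unfolding dsum_def \<alpha>(2) by (simp add: \<alpha>_def)
  have "indecomposable \<alpha>"
    unfolding indecomposable_def
  proof
    show "\<alpha> \<noteq> []" using \<alpha>(2) k by auto
    show "first_index \<alpha> = length \<alpha>"
      unfolding first_index_def \<alpha>(2)
    proof (rule Least_equality)
      show "1 \<le> k \<and> set (take k \<alpha>) = {1..k}" using k by (simp add: \<alpha>_def)
    next
      fix i assume i: "1 \<le> i \<and> set (take i \<alpha>) = {1..i}"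
      show "k \<le> i"
      proof (rule ccontr)
        assume "\<not> k \<le> i"
        then have "1 \<le> i \<and> set (take i \<pi>) = {1..i}" using i by (simp add: \<alpha>_def)
        then have "k \<le> i" unfolding k_def first_index_def by (rule Least_le)
        with \<open>\<not> k \<le> i\<close> show False by simp
      qed
    qed
  qed
  with that \<alpha> \<beta> eq show thesis by blast
qed

lemma not_indecomposable_dsum:
  assumes "\<alpha> \<in> permutations_of_set {1..k}" "indecomposable \<alpha>" "\<beta> \<noteq> []"
  shows "\<not> indecomposable (dsum \<alpha> \<beta>)"
  using assms first_index_dsum[OF assms(1,2), of \<beta>] perm_length[OF assms(1)]
  by (simp add: indecomposable_def)

definition ind_perms :: "nat list \<Rightarrow> nat \<Rightarrow> nat list set" where
  "ind_perms \<sigma> n = {\<pi> \<in> av_perms \<sigma> n. indecomposable \<pi>}"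

text \<open>The hypothesis covers four pairs (\<sigma>, \<sigma>'): (2314, 231), (3124, 312), (231,
  231) and (312, 312). Keeping \<open>k < n\<close> makes \<beta> nonempty and leaves out exactly
  the indecomposable permutations.\<close>

lemma bij_dsum:
  assumes H: "\<And>k m \<alpha> \<beta>. \<alpha> \<in> permutations_of_set {1..k} \<Longrightarrow> \<beta> \<in> permutations_of_set {1..m} \<Longrightarrow> m > 0 \<Longrightarrow>
      contains_pattern \<sigma> (dsum \<alpha> \<beta>) \<longleftrightarrow> contains_pattern \<sigma>' \<alpha> \<or> contains_pattern \<sigma> \<beta>"
    and n: "n > 0"
  shows "bij_betw (\<lambda>(k, \<alpha>, \<beta>). dsum \<alpha> \<beta>)
    (SIGMA k:{1..<n}. ind_perms \<sigma>' k \<times> av_perms \<sigma> (n - k))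
    (av_perms \<sigma> n - ind_perms \<sigma> n)"
  (is "bij_betw ?f ?A ?B")
  unfolding bij_betw_def
proof
  show "inj_on ?f ?A"
  proof (rule inj_onI)
    fix x y assume *: "x \<in> ?A" "y \<in> ?A" "?f x = ?f y"
    obtain k \<alpha> \<beta> l \<gamma> \<delta> where xy: "x = (k, \<alpha>, \<beta>)" "y = (l, \<gamma>, \<delta>)"
      by (metis prod_cases3)
    with * have "\<alpha> \<in> ind_perms \<sigma>' k" "\<gamma> \<in> ind_perms \<sigma>' l" and eq: "dsum \<alpha> \<beta> = dsum \<gamma> \<delta>"
      by auto
    then have "k = l" "length \<alpha> = k" "length \<gamma> = l"
      using first_index_dsum[of \<alpha> k \<beta>] first_index_dsum[of \<gamma> l \<delta>]
      by (auto simp: ind_perms_def av_perms_def perm_length)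
    with eq show "x = y"
      by (simp add: xy dsum_def inj_map_eq_map)
  qed
  show "?f ` ?A = ?B"
  proof (intro equalityI subsetI)
    fix \<pi> assume "\<pi> \<in> ?f ` ?A"
    then obtain k \<alpha> \<beta> where *: "k \<in> {1..<n}" "\<alpha> \<in> ind_perms \<sigma>' k" "\<beta> \<in> av_perms \<sigma> (n - k)"
      "\<pi> = dsum \<alpha> \<beta>"
      by auto
    then have p: "\<alpha> \<in> permutations_of_set {1..k}" "indecomposable \<alpha>" "\<not> contains_pattern \<sigma>' \<alpha>"
      "\<beta> \<in> permutations_of_set {1..n - k}" "\<not> contains_pattern \<sigma> \<beta>" "n - k > 0" "k + (n - k) = n"
      by (auto simp: ind_perms_def av_perms_def avoids_def)
    have "\<beta> \<noteq> []" using perm_length[OF p(4)] p(6) by auto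
    with not_indecomposable_dsum[OF p(1,2)] H[OF p(1,4,6)] dsum_perm[OF p(1,4)] p
    show "\<pi> \<in> ?B"
      by (simp add: *(4) av_perms_def ind_perms_def avoids_def)
  next
    fix \<pi> assume "\<pi> \<in> ?B"
    then have \<pi>: "\<pi> \<in> permutations_of_set {1..n}" "\<not> indecomposable \<pi>" "\<not> contains_pattern \<sigma> \<pi>"
      by (auto simp: ind_perms_def av_perms_def avoids_def)
    define k where "k = first_index \<pi>"
      from dsum_decompose[OF \<pi>(1) n, folded k_def] obtain \<alpha> \<beta> where
        p: "\<alpha> \<in> permutations_of_set {1..k}" "\<beta> \<in> permutations_of_set {1..n - k}"
          "indecomposable \<alpha>" "\<pi> = dsum \<alpha> \<beta>" .
      have "k \<noteq> n"
        using \<pi>(2) perm_length[OF \<pi>(1)] n unfolding indecomposable_def k_def by auto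
      with first_index[OF \<pi>(1) n, folded k_def] have k: "k \<in> {1..<n}" "n - k > 0" by auto
      have "\<alpha> \<in> ind_perms \<sigma>' k" "\<beta> \<in> av_perms \<sigma> (n - k)"
        using H[OF p(1,2) k(2)] p \<pi>(3) by (auto simp: ind_perms_def av_perms_def avoids_def)
      with k(1) p(4) show "\<pi> \<in> ?f ` ?A" by (intro image_eqI[of _ _ "(k, \<alpha>, \<beta>)"]) auto
  qed
qed

section \<open>Descent polynomials and their product rule\<close>

lemma sum_monom_descents:
  assumes "n > 0" "finite S" "\<And>\<pi>. \<pi> \<in> S \<Longrightarrow> length \<pi> = n"
  shows "(\<Sum>i<n. monom (of_nat (card {\<pi> \<in> S. card (descents \<pi>) = i})) i) =
    (\<Sum>\<pi>\<in>S. monom (1 :: real) (card (descents \<pi>)))"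
proof -
  have "card (descents \<pi>) < n" if "\<pi> \<in> S" for \<pi>
    using card_descents_less[of \<pi>] assms(1) assms(3)[OF that] by fastforce
  then have "(\<Sum>\<pi>\<in>S. monom (1 :: real) (card (descents \<pi>))) =
      (\<Sum>i<n. \<Sum>\<pi> | \<pi> \<in> S \<and> card (descents \<pi>) = i. monom 1 (card (descents \<pi>)))"
    using assms(2) by (intro sum.group[symmetric]) auto
  also have "\<dots> = (\<Sum>i<n. monom (of_nat (card {\<pi> \<in> S. card (descents \<pi>) = i})) i)"
  proof (rule sum.cong)
    fix i
    have "(\<Sum>\<pi> | \<pi> \<in> S \<and> card (descents \<pi>) = i. monom (1 :: real) (card (descents \<pi>))) =
        (\<Sum>\<pi> | \<pi> \<in> S \<and> card (descents \<pi>) = i. monom 1 i)"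
      by (intro sum.cong) auto
    then show "(\<Sum>\<pi> | \<pi> \<in> S \<and> card (descents \<pi>) = i. monom (1 :: real) (card (descents \<pi>))) =
        monom (of_nat (card {\<pi> \<in> S. card (descents \<pi>) = i})) i"
      by (simp add: of_nat_poly mult_monom[of _ 0, simplified] monom_0[symmetric] mult_monom)
  qed simp
  finally show ?thesis by simp
qed

text \<open>Summing over permutations instead of over descent numbers lets the additivity of
  descents turn direct sums into products.\<close>

definition qsum :: "nat list set \<Rightarrow> real poly" where
  "qsum S = (\<Sum>\<pi>\<in>S. monom 1 (card (descents \<pi>)))"

lemma av_gf_nth: "\<sigma> \<noteq> [] \<Longrightarrow> fps_nth (av_gf \<sigma>) n = qsum (av_perms \<sigma> n)"
proof (cases "n = 0")
  case False
  then show ?thesis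
    using sum_monom_descents[of n "av_perms \<sigma> n", OF _ _ av_perms_D(2)]
    by (simp add: av_gf_def av_num_def qsum_def)
qed (simp add: av_gf_def qsum_def av_perms_0 descents_def)

lemma indec_gf_nth: "\<sigma> \<noteq> [] \<Longrightarrow> fps_nth (indec_gf \<sigma>) n = qsum (ind_perms \<sigma> n)"
proof (cases "n = 0")
  case False
  then show ?thesis
    using sum_monom_descents[of n "ind_perms \<sigma> n"] av_perms_D(2)[of _ \<sigma> n]
    by (simp add: indec_gf_def indec_num_def ind_perms_def qsum_def)
next
  case True
  moreover assume "\<sigma> \<noteq> []"
  ultimately have "ind_perms \<sigma> n = {}"
    by (auto simp: ind_perms_def av_perms_0 indecomposable_def)
  with True show ?thesis by (simp add: indec_gf_def qsum_def)
qed

lemma av_gf_decomposition: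
  assumes H: "\<And>k m \<alpha> \<beta>. \<alpha> \<in> permutations_of_set {1..k} \<Longrightarrow> \<beta> \<in> permutations_of_set {1..m} \<Longrightarrow> m > 0 \<Longrightarrow>
      contains_pattern \<sigma> (dsum \<alpha> \<beta>) \<longleftrightarrow> contains_pattern \<sigma>' \<alpha> \<or> contains_pattern \<sigma> \<beta>"
    and ne: "\<sigma> \<noteq> []" "\<sigma>' \<noteq> []"
  shows "av_gf \<sigma> = 1 + indec_gf \<sigma> + indec_gf \<sigma>' * (av_gf \<sigma> - 1)"
proof (rule fps_ext)
  fix n
  note gf = av_gf_nth[OF ne(1)] indec_gf_nth[OF ne(1)] indec_gf_nth[OF ne(2)]
  have 0: "qsum (av_perms \<sigma> 0) = 1" "qsum (ind_perms \<sigma> 0) = 0" "qsum (ind_perms \<sigma>' 0) = 0"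
    by (auto simp: qsum_def ind_perms_def av_perms_0 ne descents_def indecomposable_def)
  show "fps_nth (av_gf \<sigma>) n = fps_nth (1 + indec_gf \<sigma> + indec_gf \<sigma>' * (av_gf \<sigma> - 1)) n"
  proof (cases "n = 0")
    case True
    then show ?thesis by (simp add: gf 0)
  next
    case False
    then have n: "n > 0" by simp
    have sub: "ind_perms \<sigma> n \<subseteq> av_perms \<sigma> n" by (auto simp: ind_perms_def)
    have fin: "finite (ind_perms \<tau> k)" for \<tau> k by (simp add: ind_perms_def)
    have "qsum (av_perms \<sigma> n - ind_perms \<sigma> n) =
        (\<Sum>(k, \<alpha>, \<beta>)\<in>(SIGMA k:{1..<n}. ind_perms \<sigma>' k \<times> av_perms \<sigma> (n - k)).
          monom 1 (card (descents (dsum \<alpha> \<beta>))))"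
      unfolding qsum_def
      by (subst sum.reindex_bij_betw[OF bij_dsum[OF H n], symmetric]) (auto simp: case_prod_unfold)
    also have "\<dots> = (\<Sum>k\<in>{1..<n}. \<Sum>(\<alpha>, \<beta>)\<in>ind_perms \<sigma>' k \<times> av_perms \<sigma> (n - k).
          monom 1 (card (descents (dsum \<alpha> \<beta>))))"
      by (rule sum.Sigma[symmetric]) (auto simp: fin)
    also have "\<dots> = (\<Sum>k\<in>{1..<n}. \<Sum>(\<alpha>, \<beta>)\<in>ind_perms \<sigma>' k \<times> av_perms \<sigma> (n - k).
          monom 1 (card (descents \<alpha>)) * monom 1 (card (descents \<beta>)))"
    proof (intro sum.cong refl, clarify)
      fix k \<alpha> \<beta> assume "\<alpha> \<in> ind_perms \<sigma>' k" "\<beta> \<in> av_perms \<sigma> (n - k)"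
      then show "monom (1 :: real) (card (descents (dsum \<alpha> \<beta>))) =
          monom 1 (card (descents \<alpha>)) * monom 1 (card (descents \<beta>))"
        using descents_dsum[of \<alpha> k \<beta> "n - k"]
        by (simp add: mult_monom ind_perms_def av_perms_def)
    qed
    also have "\<dots> = (\<Sum>k\<in>{1..<n}. qsum (ind_perms \<sigma>' k) * qsum (av_perms \<sigma> (n - k)))"
      by (simp add: qsum_def sum_product sum.cartesian_product)
    \<comment> \<open>The new terms \<open>k = 0\<close> and \<open>k = n\<close> vanish, since
      neither \<open>indec_gf \<sigma>'\<close> nor \<open>av_gf \<sigma> - 1\<close> has a constant
      term.\<close>
    also have "\<dots> = (\<Sum>k\<in>{0..n}. fps_nth (indec_gf \<sigma>') k * fps_nth (av_gf \<sigma> - 1) (n - k))"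
    proof (rule sum.mono_neutral_cong_left)
      show "\<forall>k\<in>{0..n} - {1..<n}. fps_nth (indec_gf \<sigma>') k * fps_nth (av_gf \<sigma> - 1) (n - k) = 0"
      proof
        fix k assume "k \<in> {0..n} - {1..<n}"
        then have "k = 0 \<or> k = n" by auto
        then show "fps_nth (indec_gf \<sigma>') k * fps_nth (av_gf \<sigma> - 1) (n - k) = 0"
          by (auto simp: gf 0)
      qed
    qed (auto simp: gf)
    finally have "qsum (av_perms \<sigma> n - ind_perms \<sigma> n) =
        fps_nth (indec_gf \<sigma>' * (av_gf \<sigma> - 1)) n"
      by (simp add: fps_mult_nth)
    moreover have "qsum (av_perms \<sigma> n) =
        qsum (av_perms \<sigma> n - ind_perms \<sigma> n) + qsum (ind_perms \<sigma> n)"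
      unfolding qsum_def by (rule sum.subset_diff[OF sub]) simp
    ultimately show ?thesis using n by (simp add: gf)
  qed
qed

section \<open>Pattern occurrences in direct sums\<close>

lemma contains_312:
  "contains_pattern [3, 1, 2] xs \<longleftrightarrow>
    (\<exists>i j l. i < j \<and> j < l \<and> l < length xs \<and> xs ! j < xs ! l \<and> xs ! l < xs ! i)"
proof
  assume "contains_pattern [3, 1, 2] xs"
  then obtain f :: "nat \<Rightarrow> nat" where "f 0 < f 1" "f 1 < f 2" "f 2 < length xs"
      "xs ! f 1 < xs ! f 2" "xs ! f 2 < xs ! f 0"
    unfolding contains_pattern_iff by (auto simp: All_less_Suc numeral_nat)
  then show "\<exists>i j l. i < j \<and> j < l \<and> l < length xs \<and> xs ! j < xs ! l \<and> xs ! l < xs ! i"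
    by blast
next
  assume "\<exists>i j l. i < j \<and> j < l \<and> l < length xs \<and> xs ! j < xs ! l \<and> xs ! l < xs ! i"
  then obtain i j l where "i < j" "j < l" "l < length xs" "xs ! j < xs ! l" "xs ! l < xs ! i"
    by blast
  then show "contains_pattern [3, 1, 2] xs"
    unfolding contains_pattern_iff
    by (intro exI[of _ "(!) [i, j, l]"]) (simp add: All_less_Suc)
qed

lemma contains_3124:
  "contains_pattern [3, 1, 2, 4] xs \<longleftrightarrow>
    (\<exists>i j l m. i < j \<and> j < l \<and> l < m \<and> m < length xs \<and>
      xs ! j < xs ! l \<and> xs ! l < xs ! i \<and> xs ! i < xs ! m)"
proof
  assume "contains_pattern [3, 1, 2, 4] xs"
  then obtain f :: "nat \<Rightarrow> nat" where "f 0 < f 1" "f 1 < f 2" "f 2 < f 3" "f 3 < length xs"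
      "xs ! f 1 < xs ! f 2" "xs ! f 2 < xs ! f 0" "xs ! f 0 < xs ! f 3"
    unfolding contains_pattern_iff by (auto simp: All_less_Suc numeral_nat)
  then show "\<exists>i j l m. i < j \<and> j < l \<and> l < m \<and> m < length xs \<and>
      xs ! j < xs ! l \<and> xs ! l < xs ! i \<and> xs ! i < xs ! m"
    by blast
next
  assume "\<exists>i j l m. i < j \<and> j < l \<and> l < m \<and> m < length xs \<and>
      xs ! j < xs ! l \<and> xs ! l < xs ! i \<and> xs ! i < xs ! m"
  then obtain i j l m where "i < j" "j < l" "l < m" "m < length xs"
      "xs ! j < xs ! l" "xs ! l < xs ! i" "xs ! i < xs ! m"
    by blast
  then show "contains_pattern [3, 1, 2, 4] xs"
    unfolding contains_pattern_iff
    by (intro exI[of _ "(!) [i, j, l, m]"]) (simp add: All_less_Suc)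
qed

lemma contains_dsum_left:
  assumes "contains_pattern \<tau> \<alpha>"
  shows "contains_pattern \<tau> (dsum \<alpha> \<beta>)"
proof -
  from assms obtain f where f: "\<forall>b<length \<tau>. \<forall>a<b. f a < f b" "\<forall>a<length \<tau>. f a < length \<alpha>"
    "\<forall>a<length \<tau>. \<forall>b<length \<tau>. \<alpha> ! f a < \<alpha> ! f b \<longleftrightarrow> \<tau> ! a < \<tau> ! b"
    unfolding contains_pattern_iff by (elim exE conjE)
  then show ?thesis
    unfolding contains_pattern_iff
    by (intro exI[of _ f] conjI allI impI) (simp_all add: dsum_nth trans_less_add1)
qed

lemma contains_dsum_right:
  assumes "contains_pattern \<tau> \<beta>"
  shows "contains_pattern \<tau> (dsum \<alpha> \<beta>)"
proof -
  from assms obtain f where f: "\<forall>b<length \<tau>. \<forall>a<b. f a < f b" "\<forall>a<length \<tau>. f a < length \<beta>"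
    "\<forall>a<length \<tau>. \<forall>b<length \<tau>. \<beta> ! f a < \<beta> ! f b \<longleftrightarrow> \<tau> ! a < \<tau> ! b"
    unfolding contains_pattern_iff by (elim exE conjE)
  then show ?thesis
    unfolding contains_pattern_iff
    by (intro exI[of _ "\<lambda>a. length \<alpha> + f a"] conjI allI impI) (simp_all add: dsum_nth)
qed

context
  fixes \<alpha> \<beta> :: "nat list" and k m :: nat
  assumes \<alpha>: "\<alpha> \<in> permutations_of_set {1..k}" and \<beta>: "\<beta> \<in> permutations_of_set {1..m}"
    and m: "m > 0"
begin

lemma dsum_lengths: "length \<alpha> = k" "length \<beta> = m"
  using perm_length[OF \<alpha>] perm_length[OF \<beta>] by auto

lemma dsum_low: "i < k \<Longrightarrow> dsum \<alpha> \<beta> ! i = \<alpha> ! i \<and> \<alpha> ! i \<le> k"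
  using perm_nth[OF \<alpha>, of i] by (simp add: dsum_nth dsum_lengths)

lemma dsum_high: "k \<le> i \<Longrightarrow> i < k + m \<Longrightarrow> dsum \<alpha> \<beta> ! i = k + \<beta> ! (i - k) \<and> k < dsum \<alpha> \<beta> ! i"
proof -
  assume i: "k \<le> i" "i < k + m"
  then have "1 \<le> \<beta> ! (i - k)" by (intro perm_nth[OF \<beta>]) linarith
  with i show ?thesis by (simp add: dsum_nth dsum_lengths)
qed

lemma dsum_le_iff: "i < k + m \<Longrightarrow> dsum \<alpha> \<beta> ! i \<le> k \<longleftrightarrow> i < k"
  using dsum_low[of i] dsum_high[of i] by force

lemma dsum_window:
  assumes "i < k + m" "j < k + m" "dsum \<alpha> \<beta> ! i < dsum \<alpha> \<beta> ! j" "j < k"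
  shows "i < k"
  using assms dsum_le_iff[of i] dsum_le_iff[of j] by linarith

text \<open>The last letter of 231 is below the first, so an occurrence that starts in \<alpha> also
  ends there. The same holds for 312.\<close>

lemma contains_231_dsum:
  "contains_pattern [2, 3, 1] (dsum \<alpha> \<beta>) \<longleftrightarrow>
    contains_pattern [2, 3, 1] \<alpha> \<or> contains_pattern [2, 3, 1] \<beta>"
proof
  assume "contains_pattern [2, 3, 1] (dsum \<alpha> \<beta>)"
  then obtain i j l where *: "i < j" "j < l" "l < k + m"
    "dsum \<alpha> \<beta> ! l < dsum \<alpha> \<beta> ! i" "dsum \<alpha> \<beta> ! i < dsum \<alpha> \<beta> ! j"
    unfolding contains_231 has231_def length_dsum dsum_lengths by blast
  show "contains_pattern [2, 3, 1] \<alpha> \<or> contains_pattern [2, 3, 1] \<beta>"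
  proof (cases "i < k")
    case True
    then have "l < k" using dsum_window[of l i] * by simp
    then have "has231 \<alpha> (length \<alpha>)"
      unfolding has231_def using * True dsum_low[of i] dsum_low[of j] dsum_low[of l]
      by (intro exI[of _ i] exI[of _ j] exI[of _ l]) (simp add: dsum_lengths)
    then show ?thesis by (simp only: contains_231 simp_thms)
  next
    case False
    then have "has231 \<beta> (length \<beta>)"
      unfolding has231_def using * dsum_high[of i] dsum_high[of j] dsum_high[of l]
      by (intro exI[of _ "i - k"] exI[of _ "j - k"] exI[of _ "l - k"]) (simp add: dsum_lengths, linarith)
    then show ?thesis by (simp only: contains_231 simp_thms)
  qed
qed (use contains_dsum_left contains_dsum_right in blast)

lemma contains_312_dsum:
  "contains_pattern [3, 1, 2] (dsum \<alpha> \<beta>) \<longleftrightarrow>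
    contains_pattern [3, 1, 2] \<alpha> \<or> contains_pattern [3, 1, 2] \<beta>"
proof
  assume "contains_pattern [3, 1, 2] (dsum \<alpha> \<beta>)"
  then obtain i j l where *: "i < j" "j < l" "l < k + m"
    "dsum \<alpha> \<beta> ! j < dsum \<alpha> \<beta> ! l" "dsum \<alpha> \<beta> ! l < dsum \<alpha> \<beta> ! i"
    unfolding contains_312 length_dsum dsum_lengths by blast
  show "contains_pattern [3, 1, 2] \<alpha> \<or> contains_pattern [3, 1, 2] \<beta>"
  proof (cases "i < k")
    case True
    then have "l < k" using dsum_window[of l i] * by simp
    then have "contains_pattern [3, 1, 2] \<alpha>"
      unfolding contains_312 using * True dsum_low[of i] dsum_low[of j] dsum_low[of l]
      by (intro exI[of _ i] exI[of _ j] exI[of _ l]) (simp add: dsum_lengths)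
    then show ?thesis ..
  next
    case False
    then have "contains_pattern [3, 1, 2] \<beta>"
      unfolding contains_312 using * dsum_high[of i] dsum_high[of j] dsum_high[of l]
      by (intro exI[of _ "i - k"] exI[of _ "j - k"] exI[of _ "l - k"]) (simp add: dsum_lengths, linarith)
    then show ?thesis ..
  qed
qed (use contains_dsum_left contains_dsum_right in blast)

lemma contains_2314_dsum:
  "contains_pattern [2, 3, 1, 4] (dsum \<alpha> \<beta>) \<longleftrightarrow>
    contains_pattern [2, 3, 1] \<alpha> \<or> contains_pattern [2, 3, 1, 4] \<beta>"
proof
  assume "contains_pattern [2, 3, 1, 4] (dsum \<alpha> \<beta>)"
  then obtain i j l p where *: "i < j" "j < l" "l < p" "p < k + m"
    "dsum \<alpha> \<beta> ! l < dsum \<alpha> \<beta> ! i" "dsum \<alpha> \<beta> ! i < dsum \<alpha> \<beta> ! j" "dsum \<alpha> \<beta> ! j < dsum \<alpha> \<beta> ! p"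
    unfolding contains_2314 has2314_def length_dsum dsum_lengths by blast
  show "contains_pattern [2, 3, 1] \<alpha> \<or> contains_pattern [2, 3, 1, 4] \<beta>"
  proof (cases "i < k")
    case True
    then have "l < k" using dsum_window[of l i] * by simp
    then have "has231 \<alpha> (length \<alpha>)"
      unfolding has231_def using * True dsum_low[of i] dsum_low[of j] dsum_low[of l]
      by (intro exI[of _ i] exI[of _ j] exI[of _ l]) (simp add: dsum_lengths)
    then show ?thesis by (simp only: contains_231 simp_thms)
  next
    case False
    then have "has2314 \<beta> (length \<beta>)"
      unfolding has2314_def using * dsum_high[of i] dsum_high[of j] dsum_high[of l] dsum_high[of p]
      by (intro exI[of _ "i - k"] exI[of _ "j - k"] exI[of _ "l - k"] exI[of _ "p - k"])
         (simp add: dsum_lengths, linarith)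
    then show ?thesis by (simp only: contains_2314 simp_thms)
  qed
next
  assume "contains_pattern [2, 3, 1] \<alpha> \<or> contains_pattern [2, 3, 1, 4] \<beta>"
  then show "contains_pattern [2, 3, 1, 4] (dsum \<alpha> \<beta>)"
  proof
    assume "contains_pattern [2, 3, 1] \<alpha>"
    then obtain i j l where "i < j" "j < l" "l < k" "\<alpha> ! l < \<alpha> ! i" "\<alpha> ! i < \<alpha> ! j"
      unfolding contains_231 has231_def length_dsum dsum_lengths by blast
    \<comment> \<open>The first entry of \<beta>, at position \<open>k\<close>, plays the 4.\<close>
    then show ?thesis
      unfolding contains_2314 has2314_def using dsum_low[of i] dsum_low[of j] dsum_low[of l] dsum_high[of k] m
      by (intro exI[of _ i] exI[of _ j] exI[of _ l] exI[of _ k]) (simp add: dsum_lengths)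
  qed (rule contains_dsum_right)
qed

lemma contains_3124_dsum:
  "contains_pattern [3, 1, 2, 4] (dsum \<alpha> \<beta>) \<longleftrightarrow>
    contains_pattern [3, 1, 2] \<alpha> \<or> contains_pattern [3, 1, 2, 4] \<beta>"
proof
  assume "contains_pattern [3, 1, 2, 4] (dsum \<alpha> \<beta>)"
  then obtain i j l p where *: "i < j" "j < l" "l < p" "p < k + m"
    "dsum \<alpha> \<beta> ! j < dsum \<alpha> \<beta> ! l" "dsum \<alpha> \<beta> ! l < dsum \<alpha> \<beta> ! i" "dsum \<alpha> \<beta> ! i < dsum \<alpha> \<beta> ! p"
    unfolding contains_3124 length_dsum dsum_lengths by blast
  show "contains_pattern [3, 1, 2] \<alpha> \<or> contains_pattern [3, 1, 2, 4] \<beta>"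
  proof (cases "i < k")
    case True
    then have "l < k" using dsum_window[of l i] * by simp
    then have "contains_pattern [3, 1, 2] \<alpha>"
      unfolding contains_312 using * True dsum_low[of i] dsum_low[of j] dsum_low[of l]
      by (intro exI[of _ i] exI[of _ j] exI[of _ l]) (simp add: dsum_lengths)
    then show ?thesis ..
  next
    case False
    then have "contains_pattern [3, 1, 2, 4] \<beta>"
      unfolding contains_3124 using * dsum_high[of i] dsum_high[of j] dsum_high[of l] dsum_high[of p]
      by (intro exI[of _ "i - k"] exI[of _ "j - k"] exI[of _ "l - k"] exI[of _ "p - k"])
         (simp add: dsum_lengths, linarith)
    then show ?thesis ..
  qed
next
  assume "contains_pattern [3, 1, 2] \<alpha> \<or> contains_pattern [3, 1, 2, 4] \<beta>"
  then show "contains_pattern [3, 1, 2, 4] (dsum \<alpha> \<beta>)"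
  proof
    assume "contains_pattern [3, 1, 2] \<alpha>"
    then obtain i j l where "i < j" "j < l" "l < k" "\<alpha> ! j < \<alpha> ! l" "\<alpha> ! l < \<alpha> ! i"
      unfolding contains_312 length_dsum dsum_lengths by blast
    then show ?thesis
      unfolding contains_3124 using dsum_low[of i] dsum_low[of j] dsum_low[of l] dsum_high[of k] m
      by (intro exI[of _ i] exI[of _ j] exI[of _ l] exI[of _ k]) (simp add: dsum_lengths)
  qed (rule contains_dsum_right)
qed

end

section \<open>Generating functions\<close>

definition eval_q1 :: "real poly fps \<Rightarrow> real fps" where
  "eval_q1 f = Abs_fps (\<lambda>n. poly (fps_nth f n) 1)"

lemma eval_q1_simps [simp]:
  "eval_q1 1 = 1" "eval_q1 (f + g) = eval_q1 f + eval_q1 g"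
  "eval_q1 (f - g) = eval_q1 f - eval_q1 g" "eval_q1 (f * g) = eval_q1 f * eval_q1 g"
  by (simp_all add: fps_eq_iff eval_q1_def fps_mult_nth poly_sum)

definition count_gf :: "nat list \<Rightarrow> real fps" where
  "count_gf \<sigma> = Abs_fps (\<lambda>n. real (card (av_perms \<sigma> n)))"

lemma eval_q1_av_gf: "\<sigma> \<noteq> [] \<Longrightarrow> eval_q1 (av_gf \<sigma>) = count_gf \<sigma>"
  by (simp add: fps_eq_iff eval_q1_def count_gf_def av_gf_nth qsum_def poly_sum poly_monom)

lemma eval_q1_indec_gf: "eval_q1 (indec_gf \<sigma>) = indec_gf1 \<sigma>"
  by (simp add: eval_q1_def indec_gf1_def)

text \<open>As 231 is itself indecomposable, the decomposition applies with \<sigma>' = \<sigma>; at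
  q = 1 it yields the Catalan equation.\<close>

lemma av_gf_231: "av_gf [2, 3, 1] = 1 + indec_gf [2, 3, 1] + indec_gf [2, 3, 1] * (av_gf [2, 3, 1] - 1)"
  by (rule av_gf_decomposition, rule contains_231_dsum) auto

lemma av_gf_312: "av_gf [3, 1, 2] = 1 + indec_gf [3, 1, 2] + indec_gf [3, 1, 2] * (av_gf [3, 1, 2] - 1)"
  by (rule av_gf_decomposition, rule contains_312_dsum) auto

lemma av_gf_2314:
  "av_gf [2, 3, 1, 4] = 1 + indec_gf [2, 3, 1, 4] + indec_gf [2, 3, 1] * (av_gf [2, 3, 1, 4] - 1)"
  by (rule av_gf_decomposition, rule contains_2314_dsum) auto

lemma av_gf_3124:
  "av_gf [3, 1, 2, 4] = 1 + indec_gf [3, 1, 2, 4] + indec_gf [3, 1, 2] * (av_gf [3, 1, 2, 4] - 1)"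
  by (rule av_gf_decomposition, rule contains_3124_dsum) auto

section \<open>Indecomposable 231-avoiders\<close>

lemma has231_Cons:
  assumes "\<And>x. x \<in> set xs \<Longrightarrow> x < N"
  shows "has231 (N # xs) (Suc (length xs)) \<longleftrightarrow> has231 xs (length xs)"
proof
  assume "has231 (N # xs) (Suc (length xs))"
  then obtain i j l where *: "i < j" "j < l" "l < Suc (length xs)"
    "(N # xs) ! l < (N # xs) ! i" "(N # xs) ! i < (N # xs) ! j"
    unfolding has231_def by blast
  then obtain j' l' where jl: "j = Suc j'" "l = Suc l'" by (metis less_imp_Suc_add)
  have "i \<noteq> 0" using * assms[OF nth_mem, of j'] by (cases i) (auto simp: jl)
  then obtain i' where "i = Suc i'" using not0_implies_Suc by blast
  with * show "has231 xs (length xs)"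
    unfolding has231_def jl by (intro exI[of _ i'] exI[of _ j'] exI[of _ l']) simp
next
  assume "has231 xs (length xs)"
  then obtain i j l where "i < j" "j < l" "l < length xs" "xs ! l < xs ! i" "xs ! i < xs ! j"
    unfolding has231_def by blast
  then show "has231 (N # xs) (Suc (length xs))"
    unfolding has231_def by (intro exI[of _ "Suc i"] exI[of _ "Suc j"] exI[of _ "Suc l"]) simp
qed

text \<open>If \<open>L @ [n + 1] @ \<rho>\<close> avoids 231, then all of \<open>L\<close> lies below \<open>\<rho>\<close>.\<close>

lemma ind_perms_231: "ind_perms [2, 3, 1] (Suc n) = (#) (Suc n) ` av_perms [2, 3, 1] n"
proof (intro equalityI subsetI)
  fix \<pi> assume "\<pi> \<in> (#) (Suc n) ` av_perms [2, 3, 1] n"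
  then obtain \<rho> where \<rho>: "\<rho> \<in> permutations_of_set {1..n}" "\<not> has231 \<rho> (length \<rho>)"
    and \<pi>: "\<pi> = Suc n # \<rho>"
    unfolding av_perms_def avoids_def contains_231 by blast
  have mem: "x < Suc n" if "x \<in> set \<rho>" for x
    using that \<rho>(1) by (simp add: permutations_of_set_def)
  have perm: "\<pi> \<in> permutations_of_set {1..Suc n}"
    using permutations_of_setD[OF \<rho>(1)]
    by (intro permutations_of_setI) (simp_all add: \<pi> atLeastAtMostSuc_conv)
  have len: "length \<pi> = Suc n" by (rule perm_length[OF perm])
  note fi = first_index[OF perm zero_less_Suc]
  \<comment> \<open>A prefix with value set {1..i} that contains \<open>n + 1\<close> is the whole
    word.\<close>
  have "Suc n \<in> set (take (first_index \<pi>) \<pi>)"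
    using fi(1) by (cases "first_index \<pi>") (auto simp: \<pi>)
  then have "first_index \<pi> = Suc n"
    using fi(2) unfolding fi(3) by simp
  then have "indecomposable \<pi>" by (simp add: indecomposable_def len) (simp add: \<pi>)
  moreover have "\<not> has231 \<pi> (length \<pi>)"
    using has231_Cons[OF mem] \<rho>(2) by (simp add: \<pi>)
  ultimately show "\<pi> \<in> ind_perms [2, 3, 1] (Suc n)"
    using perm unfolding ind_perms_def av_perms_def avoids_def contains_231 by blast
next
  fix \<pi> assume "\<pi> \<in> ind_perms [2, 3, 1] (Suc n)"
  then have perm: "\<pi> \<in> permutations_of_set {1..Suc n}" and ind: "indecomposable \<pi>"
    and av: "\<not> has231 \<pi> (length \<pi>)"
    unfolding ind_perms_def av_perms_def avoids_def contains_231 by blast+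
  note len = perm_length[OF perm]
  have set: "set \<pi> = {1..Suc n}" and dist: "distinct \<pi>"
    using perm by (auto simp: permutations_of_set_def)
  then have "Suc n \<in> set \<pi>" by simp
  then obtain L \<rho> where \<pi>: "\<pi> = L @ Suc n # \<rho>" by (meson split_list)
  have un: "set L \<union> set \<rho> = {1..n}"
  proof -
    have "set L \<union> set \<rho> = set \<pi> - {Suc n}" using dist by (auto simp: \<pi>)
    also have "\<dots> = {1..n}" unfolding set by (simp add: set_eq_iff) linarith
    finally show ?thesis .
  qed
  have "L = []"
  proof (rule ccontr)
    assume ne: "L \<noteq> []"
    have less: "x < y" if "x \<in> set L" "y \<in> set \<rho>" for x y
    proof (rule ccontr)
      assume "\<not> x < y"
      moreover have "x \<noteq> y" using that dist by (auto simp: \<pi>)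
      ultimately have yx: "y < x" by simp
      obtain i where i: "i < length L" "L ! i = x" using \<open>x \<in> _\<close> by (auto simp: in_set_conv_nth)
      obtain l where l: "l < length \<rho>" "\<rho> ! l = y" using \<open>y \<in> _\<close> by (auto simp: in_set_conv_nth)
      have "x \<in> {1..n}" using un that(1) by blast
      then have "x < Suc n" by simp
      then have "has231 \<pi> (length \<pi>)"
        unfolding has231_def using i l yx
        by (intro exI[of _ i] exI[of _ "length L"] exI[of _ "length L + Suc l"])
           (simp add: \<pi> nth_append)
      with av show False ..
    qed
    \<comment> \<open>With \<rho> above \<open>L\<close>, all values up to the maximum of
      \<open>L\<close> occur in \<open>L\<close>. So \<open>L\<close> is a proper prefix filling an
      initial interval, against indecomposability.\<close>
    define k where "k = Max (set L)"
    have k: "k \<in> set L" "\<And>x. x \<in> set L \<Longrightarrow> x \<le> k"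
      using ne by (auto simp: k_def)
    have "set L = {1..k}"
    proof (intro equalityI subsetI)
      fix x assume x: "x \<in> {1..k}"
      have "k \<in> {1..n}" using k(1) un by blast
      with x have "x \<in> set L \<union> set \<rho>" unfolding un by simp
      moreover have "x \<notin> set \<rho>" using less[OF k(1), of x] x by auto
      ultimately show "x \<in> set L" by blast
    next
      fix x assume "x \<in> set L"
      moreover from this have "x \<in> {1..n}" using un by blast
      ultimately show "x \<in> {1..k}" using k(2) by simp
    qed
    moreover have "distinct L" using dist by (simp add: \<pi>)
    ultimately have L: "set L = {1..length L}"
      using distinct_card[of L] by simp
    have "1 \<le> length L \<and> set (take (length L) \<pi>) = {1..length L}"
      using ne L by (cases L) (auto simp: \<pi>)
    then have "first_index \<pi> \<le> length L"
      unfolding first_index_def by (rule Least_le)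
    moreover have "first_index \<pi> = length \<pi>" using ind by (simp add: indecomposable_def)
    ultimately show False by (simp add: \<pi>)
  qed
  with \<pi> have \<pi>: "\<pi> = Suc n # \<rho>" by simp
  have "set \<rho> = {1..n}" "distinct \<rho>"
    using un \<open>L = []\<close> dist by (simp_all add: \<pi>)
  then have "\<rho> \<in> permutations_of_set {1..n}" by (simp add: permutations_of_set_def)
  moreover have "\<not> has231 \<rho> (length \<rho>)"
    using av has231_Cons[of \<rho> "Suc n"] \<open>set \<rho> = {1..n}\<close> by (simp add: \<pi>)
  ultimately have "\<rho> \<in> av_perms [2, 3, 1] n"
    unfolding av_perms_def avoids_def contains_231 by blast
  then show "\<pi> \<in> (#) (Suc n) ` av_perms [2, 3, 1] n" unfolding \<pi> by (rule imageI)
qed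

lemma indec_gf1_231: "indec_gf1 [2, 3, 1] = fps_X * count_gf [2, 3, 1]"
proof (rule fps_ext)
  fix n
  have eq: "fps_nth (indec_gf1 [2, 3, 1]) n = real (card (ind_perms [2, 3, 1] n))"
    by (simp only: indec_gf1_nth ind_perms_def)
  show "fps_nth (indec_gf1 [2, 3, 1]) n = fps_nth (fps_X * count_gf [2, 3, 1]) n"
  proof (cases n)
    case 0
    have "ind_perms [2, 3, 1] 0 = {}" by (auto simp: ind_perms_def av_perms_0 indecomposable_def)
    with 0 eq show ?thesis by simp
  next
    case (Suc m)
    have "card (ind_perms [2, 3, 1] (Suc m)) = card (av_perms [2, 3, 1] m)"
      unfolding ind_perms_231 by (rule card_image) (simp add: inj_on_def)
    with Suc eq show ?thesis by (simp add: count_gf_def)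
  qed
qed

lemma indec_gf1_eq:
  assumes "av_gf \<sigma> = 1 + indec_gf \<sigma> + indec_gf \<sigma>' * (av_gf \<sigma> - 1)" "\<sigma> \<noteq> []"
  shows "indec_gf1 \<sigma> = (1 - indec_gf1 \<sigma>') * (count_gf \<sigma> - 1)"
proof -
  from assms(1) have "eval_q1 (av_gf \<sigma>) = eval_q1 (1 + indec_gf \<sigma> + indec_gf \<sigma>' * (av_gf \<sigma> - 1))"
    by (rule arg_cong)
  then have "count_gf \<sigma> = 1 + indec_gf1 \<sigma> + indec_gf1 \<sigma>' * (count_gf \<sigma> - 1)"
    by (simp only: eval_q1_simps eval_q1_av_gf[OF assms(2)] eval_q1_indec_gf)
  then show ?thesis by algebra
qed

text \<open>With I = x C, the relation I = (1 - I) (C - 1) becomes this equation.\<close>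

lemma count_gf_231: "count_gf [2, 3, 1] = 1 + fps_X * count_gf [2, 3, 1] ^ 2"
  using indec_gf1_eq[OF av_gf_231 list.distinct(2)] indec_gf1_231 by algebra

text \<open>Both series satisfy I C = C - 1, with the same C because 231 and 312 are inverse to each
  other.\<close>

lemma indec_gf1_312: "indec_gf1 [3, 1, 2] = indec_gf1 [2, 3, 1]"
proof -
  have C: "count_gf [3, 1, 2] = count_gf [2, 3, 1]"
    unfolding count_gf_def card_av_perms_312 ..
  have "(indec_gf1 [3, 1, 2] - indec_gf1 [2, 3, 1]) * count_gf [2, 3, 1] = 0"
    using indec_gf1_eq[OF av_gf_231 list.distinct(2)] indec_gf1_eq[OF av_gf_312 list.distinct(2)]
    unfolding C by algebra
  moreover have "fps_nth (count_gf [2, 3, 1]) 0 = 1"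
    by (simp add: count_gf_def av_perms_0)
  then have "count_gf [2, 3, 1] \<noteq> 0" by (metis fps_zero_nth zero_neq_one)
  ultimately show ?thesis by simp
qed

section \<open>Binomial series and Catalan numbers\<close>

lemma binomial_series_nth: "fps_nth (binomial_series a c) n = c ^ n * (a gchoose n)"
  by (simp add: binomial_series_def fps_compose_linear)

lemma binomial_series_add: "binomial_series (a + b) c = binomial_series a c * binomial_series b c"
  by (simp add: binomial_series_def fps_binomial_add_mult fps_compose_mult_distrib)

lemma binomial_series_1: "binomial_series 1 c = 1 + fps_const c * fps_X"
  by (simp add: binomial_series_def fps_binomial_1 fps_compose_add_distrib)

lemma binomial_series_half: "binomial_series (1 / 2) c ^ 2 = 1 + fps_const c * fps_X"
  using binomial_series_add[of "1 / 2" "1 / 2" c] by (simp add: binomial_series_1 power2_eq_square)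

lemma binomial_series_three_halves: "binomial_series (3 / 2) c = binomial_series (1 / 2) c ^ 3"
  using binomial_series_add[of "1 / 2" "1" c] binomial_series_half[of c]
  by (simp add: binomial_series_1 power2_eq_square power3_eq_cube)

text \<open>Both sides are square roots of 1 - 4 x; the constant term 2 of their sum excludes
  opposite signs.\<close>

lemma binomial_series_catalan: "binomial_series (1 / 2) (- 4) = 1 - 2 * fps_X * count_gf [2, 3, 1]"
proof -
  let ?C = "count_gf [2, 3, 1]"
  let ?r = "binomial_series (1 / 2) (- 4)"
  have r: "?r ^ 2 = 1 - 4 * fps_X"
    by (simp add: binomial_series_half numeral_fps_const flip: fps_const_neg)
  have C: "?C - (1 + fps_X * ?C ^ 2) = 0"
    using count_gf_231 by (rule iffD1[OF eq_iff_diff_eq_0])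
  have "(?r - (1 - 2 * fps_X * ?C)) * (?r + (1 - 2 * fps_X * ?C)) =
      ?r ^ 2 - (1 - 4 * fps_X) + 4 * fps_X * (?C - (1 + fps_X * ?C ^ 2))"
    by (simp add: algebra_simps power2_eq_square)
  then have "(?r - (1 - 2 * fps_X * ?C)) * (?r + (1 - 2 * fps_X * ?C)) = 0"
    unfolding r C by simp
  moreover have "fps_nth (?r + (1 - 2 * fps_X * ?C)) 0 = 2"
    by (simp add: binomial_series_nth mult.assoc)
  then have "?r + (1 - 2 * fps_X * ?C) \<noteq> 0" by (metis fps_zero_nth zero_neq_numeral)
  ultimately show ?thesis by simp
qed

lemma catalan_Suc: "(real i + 2) * catalan (Suc i) = 2 * (2 * real i + 1) * catalan i"
proof -
  define a b c where "a = real (2 * i choose i)" and "b = real (Suc (2 * i) choose Suc i)"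
    and "c = real (2 * Suc i choose Suc i)"
  have "Suc (2 * i) choose i = Suc (2 * i) choose Suc i"
    using binomial_symmetric[of i "Suc (2 * i)"] by (simp add: mult_2)
  then have "Suc i * (2 * Suc i choose Suc i) = 2 * Suc i * (Suc (2 * i) choose Suc i)"
    using Suc_times_binomial_eq[of "Suc (2 * i)" i] by (simp add: mult.commute)
  then have "real (Suc i * (2 * Suc i choose Suc i)) = real (2 * Suc i * (Suc (2 * i) choose Suc i))"
    by (rule arg_cong)
  then have "real (Suc i) * c = real (Suc i) * (2 * b)"
    unfolding b_def c_def of_nat_mult by (simp only: of_nat_numeral ac_simps)
  then have "c = 2 * b" by simp
  moreover have "Suc i * (Suc (2 * i) choose Suc i) = Suc (2 * i) * (2 * i choose i)"
    using Suc_times_binomial_eq[of "2 * i" i] by (simp add: mult.commute)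
  then have "real (Suc i * (Suc (2 * i) choose Suc i)) = real (Suc (2 * i) * (2 * i choose i))"
    by (rule arg_cong)
  then have "real (Suc i) * b = real (Suc (2 * i)) * a"
    unfolding a_def b_def of_nat_mult .
  then have "b = (2 * real i + 1) * (1 / (real i + 1) * a)"
    by (simp add: field_simps)
  moreover have "catalan (Suc i) = 1 / (real i + 2) * c" "catalan i = 1 / (real i + 1) * a"
    by (simp_all add: catalan_def a_def c_def)
  ultimately show ?thesis by simp
qed

text \<open>Coefficient \<open>i + 1\<close> of \<open>binomial_series_catalan\<close>: the binomial
  coefficients of exponent 1/2, scaled by powers of -4, obey the recurrence of
  \<open>catalan_Suc\<close>.\<close>

lemma count_gf_231_nth: "fps_nth (count_gf [2, 3, 1]) i = catalan i"
proof -
  have "(- 4) ^ Suc i * (1 / 2 gchoose Suc i) = - 2 * catalan i"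
  proof (induction i)
    case 0
    then show ?case by (simp add: catalan_def)
  next
    case (Suc i)
    have "real (Suc (Suc i)) * (1 / 2 gchoose Suc (Suc i)) = (1 / 2 - real (Suc i)) * (1 / 2 gchoose Suc i)"
      using gbinomial_mult_1[of "1 / 2 :: real" "Suc i"] by (simp add: algebra_simps)
    note g = this
    have "(real i + 2) * ((- 4) ^ Suc (Suc i) * (1 / 2 gchoose Suc (Suc i))) =
        (- 4) * (- 4) ^ Suc i * (real (Suc (Suc i)) * (1 / 2 gchoose Suc (Suc i)))"
      by (simp add: algebra_simps)
    also have "\<dots> = (- 4) * (1 / 2 - real (Suc i)) * ((- 4) ^ Suc i * (1 / 2 gchoose Suc i))"
      unfolding g by (simp only: mult.assoc mult.left_commute)
    also have "\<dots> = - 2 * (2 * (2 * real i + 1) * catalan i)"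
      unfolding Suc.IH by (simp add: algebra_simps)
    also have "\<dots> = (real i + 2) * (- 2 * catalan (Suc i))"
      by (simp only: catalan_Suc[of i, symmetric] mult.left_commute)
    finally show ?case
      by (rule mult_left_cancel[THEN iffD1, rotated]) linarith
  qed
  moreover have "(- 4) ^ Suc i * (1 / 2 gchoose Suc i) = - 2 * fps_nth (count_gf [2, 3, 1]) i"
    using arg_cong[OF binomial_series_catalan, of "\<lambda>f. fps_nth f (Suc i)"]
    by (simp add: binomial_series_nth mult.assoc numeral_fps_const)
  ultimately show ?thesis by simp
qed

theorem theorem3p9:
  shows "av_gf [2, 3, 1, 4] =
           1 + indec_gf [2, 3, 1, 4] + indec_gf [2, 3, 1] * (av_gf [2, 3, 1, 4] - 1)
       \<and> av_gf [3, 1, 2, 4] =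
           1 + indec_gf [3, 1, 2, 4] + indec_gf [3, 1, 2] * (av_gf [3, 1, 2, 4] - 1)
       \<and> (\<forall>\<sigma> \<in> {[2, 3, 1, 4], [3, 1, 2, 4]}.
            indec_gf1 \<sigma> =
              fps_const (1 / 2) * (binomial_series (1 / 2) (- 4) + 1) *
              (32 * fps_X / (1 + 20 * fps_X - 8 * fps_X ^ 2 - binomial_series (3 / 2) (- 8)) - 1)
          \<and> fps_nth (indec_gf1 \<sigma>) 1 = 1
          \<and> (\<forall>n\<ge>2. fps_nth (indec_gf1 \<sigma>) n =
                real (F n) - (\<Sum>i=0..n - 2. catalan i * real (F (n - 1 - i)))))"
proof (intro conjI ballI av_gf_2314 av_gf_3124)
  fix \<sigma> :: "nat list" assume \<sigma>: "\<sigma> \<in> {[2, 3, 1, 4], [3, 1, 2, 4]}"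
  let ?C = "count_gf [2, 3, 1]"
  have "count_gf [2, 3, 1, 4] = av_series"
    by (simp only: fps_eq_iff count_gf_def av_series_nth fps_nth_Abs_fps simp_thms)
  moreover from this have "count_gf [3, 1, 2, 4] = av_series"
    by (simp only: count_gf_def card_av_perms_3124)
  ultimately have I: "indec_gf1 \<sigma> = (1 - fps_X * ?C) * (av_series - 1)"
    using \<sigma> indec_gf1_eq[OF av_gf_2314 list.distinct(2)] indec_gf1_eq[OF av_gf_3124 list.distinct(2)]
    unfolding indec_gf1_312 indec_gf1_231 by (auto simp del: One_nat_def)
  have F: "real (F m) = fps_nth av_series m" for m
    by (simp only: F_def av_series_nth card_av_perms_1342 card_av_perms_3124)
  have Z0: "fps_nth av_series 0 = 1"
    by (simp add: av_series_nth av_perms_0 del: One_nat_def)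
  show "indec_gf1 \<sigma> =
      fps_const (1 / 2) * (binomial_series (1 / 2) (- 4) + 1) *
      (32 * fps_X / (1 + 20 * fps_X - 8 * fps_X ^ 2 - binomial_series (3 / 2) (- 8)) - 1)"
  proof -
    let ?r = "binomial_series (1 / 2) (- 8)"
    have r: "?r ^ 2 = 1 - 8 * fps_X"
      by (simp add: binomial_series_half numeral_fps_const flip: fps_const_neg)
    have r0: "fps_nth ?r 0 = 1" by (simp add: binomial_series_nth)
    note av_series = av_series_closed_form[OF r r0]
    \<comment> \<open>The denominator has constant term 0 and hence no inverse. The quotient is an
      exact division, justified by \<open>32 * fps_X\<close> being \<open>av_series\<close> times a
      nonzero series.\<close>
    have "1 + 20 * fps_X - 8 * fps_X ^ 2 - ?r ^ 3 \<noteq> 0"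
      using av_series by auto
    then have "32 * fps_X / (1 + 20 * fps_X - 8 * fps_X ^ 2 - binomial_series (3 / 2) (- 8)) = av_series"
      unfolding binomial_series_three_halves av_series[symmetric] by (rule nonzero_mult_div_cancel_right)
    moreover have "fps_const (1 / 2) * (binomial_series (1 / 2) (- 4) + 1) = 1 - fps_X * ?C"
    proof -
      have "fps_const (1 / 2) * (2 * (1 - fps_X * ?C)) = 1 - fps_X * ?C"
        by (simp add: numeral_fps_const mult.assoc[symmetric] fps_const_mult)
      then show ?thesis by (simp add: binomial_series_catalan algebra_simps)
    qed
    ultimately show ?thesis by (simp only: I)
  qed
  show "fps_nth (indec_gf1 \<sigma>) 1 = 1"
    using av_series_nth_1 by (simp add: I fps_mult_nth_1 Z0)
  show "\<forall>n\<ge>2. fps_nth (indec_gf1 \<sigma>) n =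
      real (F n) - (\<Sum>i=0..n - 2. catalan i * real (F (n - 1 - i)))"
  proof (intro allI impI)
    fix n :: nat assume "n \<ge> 2"
    then obtain m where n: "n = Suc (Suc m)" by (metis add_2_eq_Suc le_Suc_ex)
    \<comment> \<open>The term \<open>i = Suc m\<close> drops out because
      \<open>av_series - 1\<close> has constant term 0; thus the sum stops at
      \<open>m = n - 2\<close>.\<close>
    have "fps_nth (?C * (av_series - 1)) (Suc m) = (\<Sum>i=0..m. catalan i * fps_nth av_series (Suc m - i))"
      by (simp add: fps_mult_nth count_gf_231_nth[simplified] Z0 Suc_diff_le)
    then show "fps_nth (indec_gf1 \<sigma>) n =
        real (F n) - (\<Sum>i=0..n - 2. catalan i * real (F (n - 1 - i)))"
      by (simp add: I n F left_diff_distrib mult.assoc)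
  qed
qed

end
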